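(* In the setting and notation of the context, assume that admissible contours exist for both $l=+1$ and $l=-1$. Let $l\in\{+1,-1\}$ and let $\Gamma_l$ be an admissible contour. Then for each of $\varkappa=\triangleright$ and $\varkappa=\triangleleft$ the equation $$X=V^{\varkappa}_{\Gamma_l}(\widetilde A+X)$$ has a solution $X_\varkappa\in\mathcal B(\mathcal H_A)$ satisfying $\|X_\varkappa\|\le r_{\min}(\Gamma_l)$, where $$r_{\min}(\Gamma_l)=\tfrac12d(\Gamma_l)[1-\operatorname{Var}_{\widetilde A}(K,\Gamma_l)]-\sqrt{\tfrac14d(\Gamma_l)^2[1-\operatorname{Var}_{\widetilde A}(K,\Gamma_l)]^2-d(\Gamma_l)\operatorname{Var}_{\widetilde A}(K,\Gamma_l)\|\widetilde A\|}.$$ Moreover, for given $\varkappa=\triangleright$ or $\varkappa=\triangleleft$, this solution is the unique solution of the equation in the open ball $\{Y\in\mathcal B(\mathcal H_A):\|Y\|<r_{\max}(\Gamma_l)\}$, where $$r_{\max}(\Gamma_l)=d(\Gamma_l)-\sqrt{\operatorname{Var}_{\widetilde A}(K,\Gamma_l)\,d(\Gamma_l)\,[d(\Gamma_l)+\|\widetilde A\|]}.$$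
   Context: **Operators.** $\mathcal H_A,\mathcal H_C$ are separable Hilbert spaces; $\mathcal B(\cdot)$ denotes bounded operators. $C$ is a (possibly unbounded) self-adjoint operator in $\mathcal H_C$ with $C\ge\lambda_C>0$, whose spectrum is absolutely continuous and equals $[\lambda_C,+\infty)$. $A\in\mathcal B(\mathcal H_A)$ is not necessarily self-adjoint. $D$ is a densely defined closable operator from $\operatorname{dom}(D)\subset\mathcal H_A$ to $\mathcal H_C$ such that $C^{-1/2}D$ extends to a bounded operator $\widetilde D=\overline{C^{-1/2}D}\in\mathcal B(\mathcal H_A,\mathcal H_C)$. $B$ is a densely defined closable operator from $\operatorname{dom}(B)\subset\mathcal H_C$ to $\mathcal H_A$ with $\operatorname{dom}(B)\supset\operatorname{dom}(C^{1/2})$; then $\widetilde B=BC^{-1/2}\in\mathcal B(\mathcal H_C,\mathcal H_A)$. Put $\widetilde A=A-\widetilde B\widetilde D$. **Numerical range.** $\nu(\widetilde A)=\overline{\{\langle\widetilde Ax,x\rangle: x\in\mathcal H_A,\ \|x\|=1\}}$ is assumed to lie in $\mathcal O_\eta([\alpha_1,\alpha_2])=\{z\in\mathbb C:\operatorname{dist}(z,[\alpha_1,\alpha_2])\le\eta\}$ for some $\eta>0$ and real $\alpha_1<\alpha_2$ with $\alpha_1-\eta>\lambda_C$. **The function $K$.** Let $\{E_C(\mu)\}_{\mu\in\mathbb R}$ be the spectral family of $C$ and $K(\mu)=\widetilde BE_C(\mu)\widetilde D$. It is assumed that $K$ is continuously differentiable on $(\lambda_C,+\infty)$ in the operator norm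 topology and that it admits an analytic continuation (again denoted $K$, with derivative $K'$) from $(\lambda_C,\beta)$, where $\beta>\alpha_2+\eta$, to a simply connected domain $\mathcal D\subset\mathbb C$ with $\mathcal D\supset\mathcal O_\eta([\alpha_1,\alpha_2])$; that at the points $\lambda=\lambda_C$ and $\lambda=\beta$ it satisfies $\|K'(\mu)\|\le c|\mu-\lambda|^\gamma$, $\mu\in\mathcal D$, with some $c>0$, $\gamma\in(-1,0]$; and that $\int_\beta^\infty(1+|\mu|)^{-1}\|K'(\mu)\|\,d\mu<\infty$. **Contours.** $\mathcal D^{(\pm1)}=\mathcal D\cap\mathbb C^{\pm}$ (open upper/lower half-planes). For $l=\pm1$ we consider contours $\Gamma_l=\widetilde\Gamma_l\cup[\beta,+\infty)$, where $\widetilde\Gamma_l$ is a rectifiable Jordan curve in $\mathcal D^{(l)}$ resulting from continuous deformation of the interval $(\lambda_C,\beta)$ with the end points kept fixed; $\Gamma_l$ is traversed from $\lambda_C$ to $+\infty$. **Transformations.** For $Z\in\mathcal B(\mathcal H_A)$ with spectrum satisfying $\operatorname{dist}(\sigma(Z),\Gamma_l)>0$, $$V^{\triangleright}_{\Gamma_l}(Z)=\int_{\Gamma_l}d\mu\,K'(\mu)Z(Z-\mu)^{-1},\qquad V^{\triangleleft}_{\Gamma_l}(Z)=\int_{\Gamma_l}Z(Z-\mu)^{-1}K'(\mu)\,d\mu.$$ **Admissible contours.** Put $d(\Gamma_l)=\operatorname{dist}(\nu(\widetilde A),\Gamma_l)$ and $\operatorname{Var}_{\widetilde A}(K,\Gamma_l)=\int_{\Gamma_l}|d\mu|\frac{\|K'(\mu)\|}{\operatorname{dist}(\mu,\nu(\widetilde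 A))}$. A contour $\Gamma_l=\widetilde\Gamma_l\cup[\beta,+\infty)$, with $\widetilde\Gamma_l$ a rectifiable Jordan curve in $\mathcal D^{(l)}$ resulting from continuous deformation of $(\lambda_C,\beta)$ with the end points kept fixed, is admissible if $d(\Gamma_l)>0$, $\operatorname{Var}_{\widetilde A}(K,\Gamma_l)<1$ and $\operatorname{Var}_{\widetilde A}(K,\Gamma_l)\|\widetilde A\|<\frac14d(\Gamma_l)[1-\operatorname{Var}_{\widetilde A}(K,\Gamma_l)]^2$. *)

theory Defs
  imports "HOL-Analysis.Analysis"
begin

section \<open>Complex Hilbert spaces\<close>

class complex_vector = real_vector +
  fixes scaleC :: "complex \<Rightarrow> 'a \<Rightarrow> 'a"  (infixr "*\<^sub>C" 75)
  assumes scaleC_add_right: "a *\<^sub>C (x + y) = a *\<^sub>C x + a *\<^sub>C y"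
    and scaleC_add_left: "(a + b) *\<^sub>C x = a *\<^sub>C x + b *\<^sub>C x"
    and scaleC_scaleC: "a *\<^sub>C b *\<^sub>C x = (a * b) *\<^sub>C x"
    and scaleC_of_real: "complex_of_real r *\<^sub>C x = r *\<^sub>R x"

class complex_normed_vector = complex_vector + real_normed_vector +
  assumes norm_scaleC: "norm (a *\<^sub>C x) = cmod a * norm x"

text \<open>The inner product is linear in the first argument.  The last axiom contains
  positive definiteness.  A \<^emph>\<open>separable\<close> Hilbert space is a type that is in addition
  of class \<open>second_countable_topology\<close>.\<close>

class complex_hilbert = complex_normed_vector + complete_space +
  fixes cinner :: "'a \<Rightarrow> 'a \<Rightarrow> complex"
  assumes cinner_add_left: "cinner (x + y) z = cinner x z + cinner y z"
    and cinner_scaleC_left: "cinner (a *\<^sub>C x) y = a * cinner x y"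
    and cinner_commute: "cinner x y = cnj (cinner y x)"
    and cinner_self: "cinner x x = complex_of_real ((norm x)\<^sup>2)"


section \<open>Bounded complex-linear operators\<close>

lemma bounded_linear_scaleC: "bounded_linear (\<lambda>x::'a::complex_normed_vector. c *\<^sub>C x)"
proof (rule bounded_linear_intro)
  fix x y :: 'a and r :: real
  show "c *\<^sub>C (x + y) = c *\<^sub>C x + c *\<^sub>C y" by (rule scaleC_add_right)
  show "c *\<^sub>C (r *\<^sub>R x) = r *\<^sub>R (c *\<^sub>C x)"
    by (simp only: scaleC_of_real[symmetric] scaleC_scaleC mult.commute)
  show "norm (c *\<^sub>C x) \<le> norm x * cmod c" by (simp add: norm_scaleC)
qed

lemma scaleC_zero_right: "c *\<^sub>C (0::'a::complex_normed_vector) = 0"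
  by (rule linear_0[OF bounded_linear.linear[OF bounded_linear_scaleC]])

lemma scaleC_minus_right: "c *\<^sub>C (- x::'a::complex_normed_vector) = - (c *\<^sub>C x)"
  by (rule linear_neg[OF bounded_linear.linear[OF bounded_linear_scaleC]])

lemma scaleC_diff_right: "c *\<^sub>C (x - y::'a::complex_normed_vector) = c *\<^sub>C x - c *\<^sub>C y"
  by (rule linear_diff[OF bounded_linear.linear[OF bounded_linear_scaleC]])

lemma scaleC_scaleR: "c *\<^sub>C (r *\<^sub>R x) = r *\<^sub>R (c *\<^sub>C (x::'a::complex_vector))"
  by (simp only: scaleC_of_real[symmetric] scaleC_scaleC mult.commute)

lift_definition blinfun_scaleC :: "complex \<Rightarrow> 'a::complex_normed_vector \<Rightarrow>\<^sub>L 'a"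
  is "\<lambda>c x. c *\<^sub>C x"
  by (rule bounded_linear_scaleC)

text \<open>The library type \<open>'a \<Rightarrow>\<^sub>L 'b\<close> consists of the bounded \<^emph>\<open>real\<close>-linear maps; the space
  of bounded operators between complex spaces is its subspace of complex-linear maps, with the
  same (operator) norm.\<close>

typedef (overloaded) ('a, 'b) cblinfun  ("(_ \<Rightarrow>\<^sub>C\<^sub>L /_)" [22, 21] 21) =
  "{T :: 'a::complex_normed_vector \<Rightarrow>\<^sub>L 'b::complex_normed_vector.
      \<forall>c x. blinfun_apply T (c *\<^sub>C x) = c *\<^sub>C blinfun_apply T x}"
  morphisms blinfun_of_cblinfun CBlinfun
  by (intro exI[of _ 0]) (simp add: scaleC_zero_right)

setup_lifting type_definition_cblinfun

lift_definition cblinfun_apply ::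
    "('a::complex_normed_vector \<Rightarrow>\<^sub>C\<^sub>L 'b::complex_normed_vector) \<Rightarrow> 'a \<Rightarrow> 'b"  (infixr "*\<^sub>V" 70)
  is blinfun_apply .

lift_definition id_cblinfun :: "'a::complex_normed_vector \<Rightarrow>\<^sub>C\<^sub>L 'a"
  is id_blinfun by simp

lift_definition cblinfun_compose ::
    "('b::complex_normed_vector \<Rightarrow>\<^sub>C\<^sub>L 'c::complex_normed_vector) \<Rightarrow>
     ('a::complex_normed_vector \<Rightarrow>\<^sub>C\<^sub>L 'b) \<Rightarrow> 'a \<Rightarrow>\<^sub>C\<^sub>L 'c"  (infixl "o\<^sub>C\<^sub>L" 67)
  is blinfun_compose by simp

instantiation cblinfun :: (complex_normed_vector, complex_normed_vector) complex_normed_vector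
begin

lift_definition zero_cblinfun :: "'a \<Rightarrow>\<^sub>C\<^sub>L 'b" is 0
  by (simp add: scaleC_zero_right)

lift_definition plus_cblinfun :: "('a \<Rightarrow>\<^sub>C\<^sub>L 'b) \<Rightarrow> ('a \<Rightarrow>\<^sub>C\<^sub>L 'b) \<Rightarrow> 'a \<Rightarrow>\<^sub>C\<^sub>L 'b" is "(+)"
  by (simp add: blinfun.add_left scaleC_add_right)

lift_definition minus_cblinfun :: "('a \<Rightarrow>\<^sub>C\<^sub>L 'b) \<Rightarrow> ('a \<Rightarrow>\<^sub>C\<^sub>L 'b) \<Rightarrow> 'a \<Rightarrow>\<^sub>C\<^sub>L 'b" is "(-)"
  by (simp add: blinfun.diff_left scaleC_diff_right)

lift_definition uminus_cblinfun :: "('a \<Rightarrow>\<^sub>C\<^sub>L 'b) \<Rightarrow> 'a \<Rightarrow>\<^sub>C\<^sub>L 'b" is uminus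
  by (simp add: blinfun.minus_left scaleC_minus_right)

lift_definition scaleR_cblinfun :: "real \<Rightarrow> ('a \<Rightarrow>\<^sub>C\<^sub>L 'b) \<Rightarrow> 'a \<Rightarrow>\<^sub>C\<^sub>L 'b" is scaleR
  by (simp add: blinfun.scaleR_left scaleC_scaleR)

lift_definition scaleC_cblinfun :: "complex \<Rightarrow> ('a \<Rightarrow>\<^sub>C\<^sub>L 'b) \<Rightarrow> 'a \<Rightarrow>\<^sub>C\<^sub>L 'b"
  is "\<lambda>c T. blinfun_scaleC c o\<^sub>L T"
  by (simp add: blinfun_scaleC.rep_eq scaleC_scaleC mult.commute)

lift_definition norm_cblinfun :: "('a \<Rightarrow>\<^sub>C\<^sub>L 'b) \<Rightarrow> real" is norm .

definition dist_cblinfun :: "('a \<Rightarrow>\<^sub>C\<^sub>L 'b) \<Rightarrow> ('a \<Rightarrow>\<^sub>C\<^sub>L 'b) \<Rightarrow> real"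
  where "dist_cblinfun S T = norm (S - T)"

definition sgn_cblinfun :: "('a \<Rightarrow>\<^sub>C\<^sub>L 'b) \<Rightarrow> 'a \<Rightarrow>\<^sub>C\<^sub>L 'b"
  where "sgn_cblinfun T = scaleR (inverse (norm T)) T"

definition [code del]:
  "(uniformity :: (('a \<Rightarrow>\<^sub>C\<^sub>L 'b) \<times> ('a \<Rightarrow>\<^sub>C\<^sub>L 'b)) filter) =
     (INF e\<in>{0<..}. principal {(S, T). dist S T < e})"

definition open_cblinfun :: "('a \<Rightarrow>\<^sub>C\<^sub>L 'b) set \<Rightarrow> bool"
  where [code del]: "open_cblinfun U =
     (\<forall>T\<in>U. \<forall>\<^sub>F (T', S) in uniformity. T' = T \<longrightarrow> S \<in> U)"

instance
proof
  fix S T U :: "'a \<Rightarrow>\<^sub>C\<^sub>L 'b" and r s :: real and a b :: complex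
  show "S + T + U = S + (T + U)" by transfer simp
  show "S + T = T + S" by transfer simp
  show "0 + S = S" by transfer simp
  show "- S + S = 0" by transfer simp
  show "S - T = S + - T" by transfer simp
  show "r *\<^sub>R (S + T) = r *\<^sub>R S + r *\<^sub>R T" by transfer (rule scaleR_add_right)
  show "(r + s) *\<^sub>R S = r *\<^sub>R S + s *\<^sub>R S" by transfer (rule scaleR_add_left)
  show "r *\<^sub>R s *\<^sub>R S = (r * s) *\<^sub>R S" by transfer simp
  show "1 *\<^sub>R S = S" by transfer simp
  show "a *\<^sub>C (S + T) = a *\<^sub>C S + a *\<^sub>C T"
    by transfer (auto intro!: blinfun_eqI simp: blinfun_scaleC.rep_eq blinfun.add_left scaleC_add_right)
  show "(a + b) *\<^sub>C S = a *\<^sub>C S + b *\<^sub>C S"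
    by transfer (auto intro!: blinfun_eqI simp: blinfun_scaleC.rep_eq blinfun.add_left scaleC_add_left)
  show "a *\<^sub>C b *\<^sub>C S = (a * b) *\<^sub>C S"
    by transfer (auto intro!: blinfun_eqI simp: blinfun_scaleC.rep_eq scaleC_scaleC)
  show "complex_of_real r *\<^sub>C S = r *\<^sub>R S"
    by transfer (auto intro!: blinfun_eqI simp: blinfun_scaleC.rep_eq scaleC_of_real blinfun.scaleR_left)
  show "dist S T = norm (S - T)" by (rule dist_cblinfun_def)
  show "sgn S = scaleR (inverse (norm S)) S" by (rule sgn_cblinfun_def)
  show "(uniformity :: (('a \<Rightarrow>\<^sub>C\<^sub>L 'b) \<times> ('a \<Rightarrow>\<^sub>C\<^sub>L 'b)) filter) =
     (INF e\<in>{0<..}. principal {(S, T). dist S T < e})" by (rule uniformity_cblinfun_def)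
  show "open V = (\<forall>T\<in>V. \<forall>\<^sub>F (T', S) in uniformity. T' = T \<longrightarrow> S \<in> V)"
    for V :: "('a \<Rightarrow>\<^sub>C\<^sub>L 'b) set" by (rule open_cblinfun_def)
  show "(norm S = 0) = (S = 0)" by transfer simp
  show "norm (S + T) \<le> norm S + norm T" by transfer (rule norm_triangle_ineq)
  show "norm (r *\<^sub>R S) = \<bar>r\<bar> * norm S" by transfer simp
  have le: "norm (a *\<^sub>C T) \<le> cmod a * norm T" for a and T :: "'a \<Rightarrow>\<^sub>C\<^sub>L 'b"
  proof transfer
    fix a and T :: "'a \<Rightarrow>\<^sub>L 'b"
    show "norm (blinfun_scaleC a o\<^sub>L T) \<le> cmod a * norm T"
    proof (rule norm_blinfun_bound)
      fix x
      have "norm (blinfun_apply T x) \<le> norm T * norm x" by (rule norm_blinfun)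
      then show "norm ((blinfun_scaleC a o\<^sub>L T) x) \<le> cmod a * norm T * norm x"
        by (simp add: blinfun_scaleC.rep_eq norm_scaleC mult.assoc mult_left_mono)
    qed simp
  qed
  have norm_cblinfun_nonneg: "0 \<le> norm T" for T :: "'a \<Rightarrow>\<^sub>C\<^sub>L 'b" by transfer simp
  show "norm (a *\<^sub>C S) = cmod a * norm S"
  proof (cases "a = 0")
    case True
    then show ?thesis using le[of a S] norm_cblinfun_nonneg[of "a *\<^sub>C S"] by simp
  next
    case False
    have "1 *\<^sub>C S = S"
      by transfer (auto intro!: blinfun_eqI simp: blinfun_scaleC.rep_eq
          scaleC_of_real[of 1, simplified])
    moreover have "inverse a *\<^sub>C a *\<^sub>C S = (inverse a * a) *\<^sub>C S"
      by transfer (auto intro!: blinfun_eqI simp: blinfun_scaleC.rep_eq scaleC_scaleC)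
    ultimately have "S = inverse a *\<^sub>C a *\<^sub>C S" using False by simp
    then have "norm S \<le> cmod (inverse a) * norm (a *\<^sub>C S)" using le[of "inverse a" "a *\<^sub>C S"] by simp
    then have "cmod a * norm S \<le> cmod a * (cmod (inverse a) * norm (a *\<^sub>C S))"
      by (rule mult_left_mono) simp
    also have "\<dots> = norm (a *\<^sub>C S)" using False by (simp add: norm_inverse)
    finally have "cmod a * norm S \<le> norm (a *\<^sub>C S)" .
    then show ?thesis using le[of a S] by simp
  qed
qed

end

text \<open>The inverse in the algebra of bounded operators; used only where it exists.\<close>

definition cblinfun_inv :: "('a::complex_normed_vector \<Rightarrow>\<^sub>C\<^sub>L 'a) \<Rightarrow> 'a \<Rightarrow>\<^sub>C\<^sub>L 'a" where
  "cblinfun_inv T = (THE R. R o\<^sub>C\<^sub>L T = id_cblinfun \<and> T o\<^sub>C\<^sub>L R = id_cblinfun)"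

definition numerical_range :: "('a::complex_hilbert \<Rightarrow>\<^sub>C\<^sub>L 'a) \<Rightarrow> complex set" where
  "numerical_range T = closure {cinner (T *\<^sub>V x) x | x. norm x = 1}"


section \<open>Unbounded operators\<close>

text \<open>An unbounded operator is given by its domain \<open>d\<close> and a function whose values outside
  \<open>d\<close> are irrelevant.\<close>

definition densely_defined ::
    "'a::complex_normed_vector set \<Rightarrow> ('a \<Rightarrow> 'b::complex_normed_vector) \<Rightarrow> bool" where
  "densely_defined d T \<longleftrightarrow>
     0 \<in> d \<and> (\<forall>x\<in>d. \<forall>y\<in>d. x + y \<in> d) \<and> (\<forall>c. \<forall>x\<in>d. c *\<^sub>C x \<in> d) \<and>
     closure d = UNIV \<and>
     (\<forall>x\<in>d. \<forall>y\<in>d. T (x + y) = T x + T y) \<and> (\<forall>c. \<forall>x\<in>d. T (c *\<^sub>C x) = c *\<^sub>C T x)"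

text \<open>The closure of the graph is again the graph of a function.\<close>

definition closable ::
    "'a::complex_normed_vector set \<Rightarrow> ('a \<Rightarrow> 'b::complex_normed_vector) \<Rightarrow> bool" where
  "closable d T \<longleftrightarrow> single_valued (closure ((\<lambda>x. (x, T x)) ` d))"

text \<open>The set in the second conjunct is the domain of the adjoint.\<close>

definition self_adjoint :: "'a::complex_hilbert set \<Rightarrow> ('a \<Rightarrow> 'a) \<Rightarrow> bool" where
  "self_adjoint d T \<longleftrightarrow>
     densely_defined d T \<and>
     d = {y. \<exists>z. \<forall>x\<in>d. cinner (T x) y = cinner x z} \<and>
     (\<forall>x\<in>d. \<forall>y\<in>d. cinner (T x) y = cinner x (T y))"

definition resolvent_set :: "'a::complex_normed_vector set \<Rightarrow> ('a \<Rightarrow> 'a) \<Rightarrow> complex set" where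
  "resolvent_set d T = {z. \<exists>R :: 'a \<Rightarrow>\<^sub>C\<^sub>L 'a.
     (\<forall>y. R *\<^sub>V y \<in> d \<and> T (R *\<^sub>V y) - z *\<^sub>C (R *\<^sub>V y) = y) \<and>
     (\<forall>x\<in>d. R *\<^sub>V (T x - z *\<^sub>C x) = x)}"

definition spectrum :: "'a::complex_normed_vector set \<Rightarrow> ('a \<Rightarrow> 'a) \<Rightarrow> complex set" where
  "spectrum d T = - resolvent_set d T"


section \<open>Spectral families\<close>

definition spectral_family :: "(real \<Rightarrow> ('a::complex_hilbert \<Rightarrow>\<^sub>C\<^sub>L 'a)) \<Rightarrow> bool" where
  "spectral_family E \<longleftrightarrow>
     (\<forall>s. E s o\<^sub>C\<^sub>L E s = E s \<and> (\<forall>x y. cinner (E s *\<^sub>V x) y = cinner x (E s *\<^sub>V y))) \<and>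
     (\<forall>s t. s \<le> t \<longrightarrow> E s o\<^sub>C\<^sub>L E t = E s) \<and>
     (\<forall>x s. ((\<lambda>t. E t *\<^sub>V x) \<longlongrightarrow> E s *\<^sub>V x) (at_right s)) \<and>
     (\<forall>x. ((\<lambda>t. E t *\<^sub>V x) \<longlongrightarrow> 0) at_bot) \<and>
     (\<forall>x. ((\<lambda>t. E t *\<^sub>V x) \<longlongrightarrow> x) at_top)"

text \<open>The Lebesgue--Stieltjes measure of \<open>t \<mapsto> \<langle>E(t) x, x\<rangle> = \<parallel>E(t) x\<parallel>\<^sup>2\<close>.\<close>

definition spectral_measure :: "(real \<Rightarrow> ('a::complex_hilbert \<Rightarrow>\<^sub>C\<^sub>L 'a)) \<Rightarrow> 'a \<Rightarrow> real measure" where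
  "spectral_measure E x = interval_measure (\<lambda>t. (norm (E t *\<^sub>V x))\<^sup>2)"

text \<open>The domain of \<open>f(C)\<close>, if \<open>E\<close> is the spectral family of \<open>C\<close>; in particular
  \<open>dom(C\<^sup>1\<^sup>/\<^sup>2) = spectral_dom E sqrt\<close> for \<open>C > 0\<close>, where the values of \<open>sqrt\<close> at negative
  arguments do not matter.\<close>

definition spectral_dom ::
    "(real \<Rightarrow> ('a::complex_hilbert \<Rightarrow>\<^sub>C\<^sub>L 'a)) \<Rightarrow> (real \<Rightarrow> real) \<Rightarrow> 'a set" where
  "spectral_dom E f = {x. integrable (spectral_measure E x) (\<lambda>t. (f t)\<^sup>2)}"

text \<open>\<open>T\<close>, with domain \<open>d\<close>, is the operator \<open>\<integral> f(t) dE(t)\<close>.  A linear operator in a complex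
  space is determined by its quadratic form, so the diagonal suffices.\<close>

definition spectral_integral ::
    "(real \<Rightarrow> ('a::complex_hilbert \<Rightarrow>\<^sub>C\<^sub>L 'a)) \<Rightarrow> (real \<Rightarrow> real) \<Rightarrow> 'a set \<Rightarrow> ('a \<Rightarrow> 'a) \<Rightarrow> bool" where
  "spectral_integral E f d T \<longleftrightarrow>
     d = spectral_dom E f \<and>
     (\<forall>x\<in>d. cinner (T x) x = complex_of_real (\<integral>t. f t \<partial>spectral_measure E x))"

definition spectral_family_of ::
    "(real \<Rightarrow> ('a::complex_hilbert \<Rightarrow>\<^sub>C\<^sub>L 'a)) \<Rightarrow> 'a set \<Rightarrow> ('a \<Rightarrow> 'a) \<Rightarrow> bool" where
  "spectral_family_of E d T \<longleftrightarrow> spectral_family E \<and> spectral_integral E (\<lambda>t. t) d T"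


section \<open>Integration along rectifiable arcs\<close>

definition rectifiable :: "(real \<Rightarrow> complex) \<Rightarrow> bool" where
  "rectifiable g \<longleftrightarrow>
     bdd_above {(\<Sum>k\<in>p. cmod (g (Sup k) - g (Inf k))) | p. p division_of {0..1}}"

text \<open>Length of the restriction of \<open>g\<close> to \<open>[0, t]\<close>, for \<open>t \<in> [0, 1]\<close>, extended by constants.\<close>

definition arc_length :: "(real \<Rightarrow> complex) \<Rightarrow> real \<Rightarrow> real" where
  "arc_length g t = Sup {(\<Sum>k\<in>p. cmod (g (Sup k) - g (Inf k))) | p. p division_of {0..min t 1}}"

text \<open>Riemann--Stieltjes integral of \<open>F(g(t)) dg(t)\<close> over \<open>[a, b]\<close>.\<close>

definition has_stieltjes_integral ::
    "(real \<Rightarrow> complex) \<Rightarrow> (complex \<Rightarrow> 'b::complex_normed_vector) \<Rightarrow> 'b \<Rightarrow> real \<Rightarrow> real \<Rightarrow> bool" where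
  "has_stieltjes_integral g F I a b \<longleftrightarrow>
     ((\<lambda>p. \<Sum>(t, k)\<in>p. (g (Sup k) - g (Inf k)) *\<^sub>C F (g t)) \<longlongrightarrow> I) (division_filter {a..b})"

text \<open>The integral over the whole arc, improper at both end points, because the integrands of
  interest may be singular there.\<close>

definition has_arc_integral ::
    "(real \<Rightarrow> complex) \<Rightarrow> (complex \<Rightarrow> 'b::complex_normed_vector) \<Rightarrow> 'b \<Rightarrow> bool" where
  "has_arc_integral g F I \<longleftrightarrow>
     (\<exists>J. (\<forall>a b. 0 < a \<and> a \<le> b \<and> b < 1 \<longrightarrow> has_stieltjes_integral g F (J (a, b)) a b) \<and>
          (J \<longlongrightarrow> I) (at_right 0 \<times>\<^sub>F at_left 1))"


section \<open>Contours\<close>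

text \<open>A contour is represented by a parametrization \<open>g\<close> on \<open>[0, 1]\<close> of its part from
  \<open>lamC\<close> to \<open>\<beta>\<close>; the ray \<open>[\<beta>, \<infinity>)\<close> is added by the following operations.\<close>

definition contour_set :: "(real \<Rightarrow> complex) \<Rightarrow> real \<Rightarrow> complex set" where
  "contour_set g \<beta> = path_image g \<union> complex_of_real ` {\<beta>..}"

definition has_contour_integral_op ::
    "(real \<Rightarrow> complex) \<Rightarrow> real \<Rightarrow> (complex \<Rightarrow> 'b::complex_normed_vector) \<Rightarrow> 'b \<Rightarrow> bool" where
  "has_contour_integral_op g \<beta> F I \<longleftrightarrow>
     (\<exists>I\<^sub>1 I\<^sub>2. has_arc_integral g F I\<^sub>1 \<and>
        ((\<lambda>t. F (complex_of_real t)) has_integral I\<^sub>2) {\<beta>..} \<and> I = I\<^sub>1 + I\<^sub>2)"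

definition arclength_integral :: "(real \<Rightarrow> complex) \<Rightarrow> real \<Rightarrow> (complex \<Rightarrow> real) \<Rightarrow> ennreal" where
  "arclength_integral g \<beta> \<phi> =
     (\<integral>\<^sup>+t\<in>{0<..<1}. ennreal (\<phi> (g t)) \<partial>interval_measure (arc_length g)) +
     (\<integral>\<^sup>+t\<in>{\<beta>..}. ennreal (\<phi> (complex_of_real t)) \<partial>lborel)"

text \<open>\<open>l = 1\<close> and \<open>l = - 1\<close> select the open upper and lower half-plane.\<close>

definition is_contour ::
    "int \<Rightarrow> real \<Rightarrow> real \<Rightarrow> complex set \<Rightarrow> (real \<Rightarrow> complex) \<Rightarrow> bool" where
  "is_contour l lamC \<beta> \<D> g \<longleftrightarrow>
     arc g \<and> rectifiable g \<and>
     pathstart g = complex_of_real lamC \<and> pathfinish g = complex_of_real \<beta> \<and>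
     (\<forall>t\<in>{0<..<1}. g t \<in> \<D> \<inter> {z. of_int l * Im z > 0}) \<and>
     homotopic_paths (\<D> \<union> {complex_of_real lamC, complex_of_real \<beta>})
       (linepath (complex_of_real lamC) (complex_of_real \<beta>)) g"

text \<open>The derivative of \<open>K\<close> along a contour: that of \<open>K\<close> itself (\<open>K\<^sub>0'\<close>) on the real axis, that
  of the analytic continuation (\<open>K\<^sub>1'\<close>) off the real axis.  On \<open>(lamC, \<beta>)\<close> the two agree.\<close>

definition contour_deriv :: "(real \<Rightarrow> 'b) \<Rightarrow> (complex \<Rightarrow> 'b) \<Rightarrow> complex \<Rightarrow> 'b" where
  "contour_deriv K\<^sub>0' K\<^sub>1' \<mu> = (if Im \<mu> = 0 then K\<^sub>0' (Re \<mu>) else K\<^sub>1' \<mu>)"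


section \<open>The transformations and admissibility\<close>

text \<open>\<open>dist(\<sigma>(Z), \<Gamma>) > 0\<close>; not phrased by \<open>setdist\<close>, which is \<open>0\<close> on the empty set.\<close>

definition spectrum_off ::
    "('a::complex_normed_vector \<Rightarrow>\<^sub>C\<^sub>L 'a) \<Rightarrow> complex set \<Rightarrow> bool" where
  "spectrum_off Z \<Gamma> \<longleftrightarrow>
     (\<exists>\<epsilon>>0. \<forall>z\<in>spectrum UNIV (cblinfun_apply Z). \<forall>\<mu>\<in>\<Gamma>. \<epsilon> \<le> dist z \<mu>)"

text \<open>The relations \<open>V\<^sup>\<triangleright>(Z) = T\<close> and \<open>V\<^sup>\<triangleleft>(Z) = T\<close>, including that the left-hand side is
  defined.\<close>

definition V_right ::
    "(real \<Rightarrow> complex) \<Rightarrow> real \<Rightarrow> (complex \<Rightarrow> ('a::complex_normed_vector \<Rightarrow>\<^sub>C\<^sub>L 'a)) \<Rightarrow>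
     ('a \<Rightarrow>\<^sub>C\<^sub>L 'a) \<Rightarrow> ('a \<Rightarrow>\<^sub>C\<^sub>L 'a) \<Rightarrow> bool" where
  "V_right g \<beta> K' Z T \<longleftrightarrow> spectrum_off Z (contour_set g \<beta>) \<and>
     has_contour_integral_op g \<beta>
       (\<lambda>\<mu>. K' \<mu> o\<^sub>C\<^sub>L Z o\<^sub>C\<^sub>L cblinfun_inv (Z - \<mu> *\<^sub>C id_cblinfun)) T"

definition V_left ::
    "(real \<Rightarrow> complex) \<Rightarrow> real \<Rightarrow> (complex \<Rightarrow> ('a::complex_normed_vector \<Rightarrow>\<^sub>C\<^sub>L 'a)) \<Rightarrow>
     ('a \<Rightarrow>\<^sub>C\<^sub>L 'a) \<Rightarrow> ('a \<Rightarrow>\<^sub>C\<^sub>L 'a) \<Rightarrow> bool" where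
  "V_left g \<beta> K' Z T \<longleftrightarrow> spectrum_off Z (contour_set g \<beta>) \<and>
     has_contour_integral_op g \<beta>
       (\<lambda>\<mu>. Z o\<^sub>C\<^sub>L cblinfun_inv (Z - \<mu> *\<^sub>C id_cblinfun) o\<^sub>C\<^sub>L K' \<mu>) T"

definition contour_dist ::
    "('a::complex_hilbert \<Rightarrow>\<^sub>C\<^sub>L 'a) \<Rightarrow> (real \<Rightarrow> complex) \<Rightarrow> real \<Rightarrow> real" where
  "contour_dist At g \<beta> = setdist (numerical_range At) (contour_set g \<beta>)"

text \<open>Extended real valued, so that a divergent integral is \<open>\<infinity>\<close>.\<close>

definition contour_var ::
    "('a::complex_hilbert \<Rightarrow>\<^sub>C\<^sub>L 'a) \<Rightarrow> (complex \<Rightarrow> ('a \<Rightarrow>\<^sub>C\<^sub>L 'a)) \<Rightarrow>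
     (real \<Rightarrow> complex) \<Rightarrow> real \<Rightarrow> ennreal" where
  "contour_var At K' g \<beta> =
     arclength_integral g \<beta> (\<lambda>\<mu>. norm (K' \<mu>) / infdist \<mu> (numerical_range At))"

definition admissible ::
    "int \<Rightarrow> real \<Rightarrow> real \<Rightarrow> complex set \<Rightarrow> ('a::complex_hilbert \<Rightarrow>\<^sub>C\<^sub>L 'a) \<Rightarrow>
     (complex \<Rightarrow> ('a \<Rightarrow>\<^sub>C\<^sub>L 'a)) \<Rightarrow> (real \<Rightarrow> complex) \<Rightarrow> bool" where
  "admissible l lamC \<beta> \<D> At K' g \<longleftrightarrow>
     is_contour l lamC \<beta> \<D> g \<and>
     contour_dist At g \<beta> > 0 \<and>
     contour_var At K' g \<beta> < 1 \<and>
     enn2real (contour_var At K' g \<beta>) * norm At <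
       1/4 * contour_dist At g \<beta> * (1 - enn2real (contour_var At K' g \<beta>))\<^sup>2"

text \<open>Radii in terms of \<open>d = d(\<Gamma>)\<close>, \<open>v = Var(K, \<Gamma>)\<close> and \<open>a = \<parallel>At\<parallel>\<close>.\<close>

definition r_min :: "real \<Rightarrow> real \<Rightarrow> real \<Rightarrow> real" where
  "r_min d v a = 1/2 * d * (1 - v) - sqrt (1/4 * d\<^sup>2 * (1 - v)\<^sup>2 - d * v * a)"

definition r_max :: "real \<Rightarrow> real \<Rightarrow> real \<Rightarrow> real" where
  "r_max d v a = d - sqrt (v * d * (d + a))"

end

theory Submission
  imports Defs "HOL-Complex_Analysis.Complex_Analysis"
begin

text \<open>Put \<open>\<delta>(\<mu>) = dist(\<mu>, \<nu>(At))\<close>, \<open>d = d(\<Gamma>)\<close>, \<open>v = Var(K, \<Gamma>)\<close> and \<open>a = \<parallel>At\<parallel>\<close>.  If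
  \<open>\<parallel>X\<parallel> \<le> r < d\<close>, the operator \<open>At + X - \<mu>\<close> is coercive with constant \<open>\<delta>(\<mu>) - r\<close>, so by the
  Lax--Milgram lemma its inverse is bounded by \<open>1 / (\<delta>(\<mu>) - r)\<close>.  Since \<open>\<delta> \<ge> d\<close> on the contour,
  \<open>\<parallel>V(At + X)\<parallel> \<le> v d (a + r) / (d - r)\<close>; from \<open>Z (Z - \<mu>)\<^sup>-\<^sup>1 = 1 + \<mu> (Z - \<mu>)\<^sup>-\<^sup>1\<close> and
  \<open>\<bar>\<mu>\<bar> \<le> \<delta>(\<mu>) + a\<close>, the map \<open>X \<mapsto> V(At + X)\<close> has Lipschitz constant \<open>v d (d + a) / (d - r)\<^sup>2\<close> on
  the ball of radius \<open>r\<close>.  The first bound leaves the ball of radius \<open>r_min\<close> invariant and the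
  second is a contraction for \<open>r < r_max\<close>.  The integrals exist because the integrands are
  continuous along the contour and dominated by a multiple of \<open>\<parallel>K'\<parallel> / \<delta>\<close>.\<close>

section \<open>Bounded operators and Hilbert spaces\<close>

text \<open>The arc is merely rectifiable and \<open>K'\<close> may be singular at its ends, so the
  operator integrals are improper Riemann-Stieltjes limits, whereas admissibility controls a
  Lebesgue integral with respect to arc length. The bridge is an indefinite integral \<Psi> of the
  density \<open>norm (K' \<mu>) / \<delta> \<mu>\<close>: on a short interval the density is nearly
  constant, so each term of a Riemann sum is at most a multiple of an increment of \<Psi> plus a
  small error, and these increments telescope. Boundedness of \<Psi> also yields the Cauchy
  criterion at the ends. The factors d in the two bounds come from the fact that
  \<open>(\<delta> + b) / (\<delta> - r)\<close> does not increase with \<delta>: such quotients are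
  replaced by their value at d, while one factor \<open>1 / \<delta>\<close> is kept to complete the
  density of Var. The two transformations differ only in the order of one product, so the argument
  is carried out for an abstract bounded bilinear product.\<close>

lemma cblinfun_eqI: "(\<And>x. S *\<^sub>V x = T *\<^sub>V x) \<Longrightarrow> S = T"
  by transfer (auto intro: blinfun_eqI)

lemma norm_cblinfun_apply: "norm (T *\<^sub>V x) \<le> norm T * norm x"
  by transfer (rule norm_blinfun)

lemma norm_cblinfun_bound: "0 \<le> b \<Longrightarrow> (\<And>x. norm (T *\<^sub>V x) \<le> b * norm x) \<Longrightarrow> norm T \<le> b"
  by transfer (rule norm_blinfun_bound)

lemma cblinfun_apply_scaleC: "T *\<^sub>V c *\<^sub>C x = c *\<^sub>C (T *\<^sub>V x)"
  by transfer auto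

lemma scaleC_one [simp]: "1 *\<^sub>C x = (x::'a::complex_vector)"
  using scaleC_of_real[of 1 x] by simp

lemma bounded_bilinear_cblinfun_apply: "bounded_bilinear cblinfun_apply"
proof
  fix S T :: "'a \<Rightarrow>\<^sub>C\<^sub>L 'b" and x y :: 'a and r :: real
  show "(S + T) *\<^sub>V x = S *\<^sub>V x + T *\<^sub>V x" by transfer (rule blinfun.add_left)
  show "S *\<^sub>V (x + y) = S *\<^sub>V x + S *\<^sub>V y" by transfer (rule blinfun.add_right)
  show "(r *\<^sub>R S) *\<^sub>V x = r *\<^sub>R (S *\<^sub>V x)" by transfer (rule blinfun.scaleR_left)
  show "S *\<^sub>V (r *\<^sub>R x) = r *\<^sub>R (S *\<^sub>V x)" by transfer (rule blinfun.scaleR_right)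
  show "\<exists>K. \<forall>S x. norm ((S :: 'a \<Rightarrow>\<^sub>C\<^sub>L 'b) *\<^sub>V x) \<le> norm S * norm x * K"
    by (rule exI[of _ 1]) (simp add: norm_cblinfun_apply)
qed

interpretation cblinfun: bounded_bilinear cblinfun_apply
  by (rule bounded_bilinear_cblinfun_apply)

lemma cblinfun_apply_compose [simp]: "(S o\<^sub>C\<^sub>L T) *\<^sub>V x = S *\<^sub>V T *\<^sub>V x"
  by transfer simp

lemma cblinfun_apply_id [simp]: "id_cblinfun *\<^sub>V x = x"
  by transfer simp

lemma cblinfun_scaleC_apply [simp]: "(c *\<^sub>C T) *\<^sub>V x = c *\<^sub>C (T *\<^sub>V x)"
  by transfer (simp add: blinfun_scaleC.rep_eq)

lemma norm_cblinfun_compose: "norm (S o\<^sub>C\<^sub>L T) \<le> norm S * norm T"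
  by transfer (rule norm_blinfun_compose)

lemma bounded_bilinear_cblinfun_compose:
  "bounded_bilinear ((o\<^sub>C\<^sub>L) :: ('b::complex_normed_vector \<Rightarrow>\<^sub>C\<^sub>L 'c::complex_normed_vector) \<Rightarrow>
     ('a::complex_normed_vector \<Rightarrow>\<^sub>C\<^sub>L 'b) \<Rightarrow> 'a \<Rightarrow>\<^sub>C\<^sub>L 'c)"
proof
  fix S S' :: "'b \<Rightarrow>\<^sub>C\<^sub>L 'c" and T T' :: "'a \<Rightarrow>\<^sub>C\<^sub>L 'b" and r :: real
  show "(S + S') o\<^sub>C\<^sub>L T = S o\<^sub>C\<^sub>L T + S' o\<^sub>C\<^sub>L T" "S o\<^sub>C\<^sub>L (T + T') = S o\<^sub>C\<^sub>L T + S o\<^sub>C\<^sub>L T'"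
    "(r *\<^sub>R S) o\<^sub>C\<^sub>L T = r *\<^sub>R (S o\<^sub>C\<^sub>L T)" "S o\<^sub>C\<^sub>L (r *\<^sub>R T) = r *\<^sub>R (S o\<^sub>C\<^sub>L T)"
    by (auto intro!: cblinfun_eqI
        simp: cblinfun.add_left cblinfun.add_right cblinfun.scaleR_left cblinfun.scaleR_right)
  show "\<exists>K. \<forall>S T. norm ((S :: 'b \<Rightarrow>\<^sub>C\<^sub>L 'c) o\<^sub>C\<^sub>L (T :: 'a \<Rightarrow>\<^sub>C\<^sub>L 'b)) \<le> norm S * norm T * K"
    by (rule exI[of _ 1]) (simp add: norm_cblinfun_compose)
qed

lemma cblinfun_compose_assoc: "(S o\<^sub>C\<^sub>L T) o\<^sub>C\<^sub>L U = S o\<^sub>C\<^sub>L (T o\<^sub>C\<^sub>L U)"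
  by (rule cblinfun_eqI) simp

lemma ex_cblinfun:
  fixes f :: "'a::complex_normed_vector \<Rightarrow> 'b::complex_normed_vector"
  assumes "bounded_linear f" "\<And>c x. f (c *\<^sub>C x) = c *\<^sub>C f x"
  shows "\<exists>T. \<forall>x. T *\<^sub>V x = f x"
  by (rule exI[of _ "CBlinfun (Blinfun f)"])
    (simp add: assms cblinfun_apply.rep_eq CBlinfun_inverse bounded_linear_Blinfun_apply)

lemma bounded_bilinear_scaleC: "bounded_bilinear ((*\<^sub>C) :: complex \<Rightarrow> 'a \<Rightarrow> 'a::complex_normed_vector)"
proof (rule bounded_bilinear.intro)
  fix a b :: complex and x y :: 'a and r :: real
  show "(a + b) *\<^sub>C x = a *\<^sub>C x + b *\<^sub>C x" by (rule scaleC_add_left)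
  show "(r *\<^sub>R a) *\<^sub>C x = r *\<^sub>R (a *\<^sub>C x)"
    by (metis scaleC_of_real scaleC_scaleC scaleR_conv_of_real)
  show "a *\<^sub>C (x + y) = a *\<^sub>C x + a *\<^sub>C y" by (rule scaleC_add_right)
  show "a *\<^sub>C (r *\<^sub>R x) = r *\<^sub>R (a *\<^sub>C x)" by (rule scaleC_scaleR)
  show "\<exists>K. \<forall>a x. norm (a *\<^sub>C (x::'a)) \<le> norm a * norm x * K"
    by (rule exI[of _ 1]) (simp add: norm_scaleC)
qed

interpretation scaleC: bounded_bilinear "(*\<^sub>C) :: complex \<Rightarrow> 'a \<Rightarrow> 'a::complex_normed_vector"
  by (rule bounded_bilinear_scaleC)

text \<open>Completeness in the operator norm underlies both the existence of the integrals, through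
  the Cauchy criterion, and the fixed-point theorem. The limit operator is assembled from pointwise
  limits.\<close>

instance cblinfun :: (complex_normed_vector, "{complex_normed_vector,complete_space}") banach
proof
  fix X :: "nat \<Rightarrow> 'a \<Rightarrow>\<^sub>C\<^sub>L 'b"
  assume "Cauchy X"
  then have C: "\<And>e. e > 0 \<Longrightarrow> \<exists>M. \<forall>m\<ge>M. \<forall>n\<ge>M. norm (X m - X n) < e"
    by (auto simp: Cauchy_def dist_norm)
  have "Cauchy (\<lambda>n. X n *\<^sub>V x)" for x
  proof (rule metric_CauchyI)
    fix e :: real assume e: "e > 0"
    \<comment> \<open>The summand 1 keeps the quotient below meaningful for
      \<open>x = 0\<close>.\<close>
    have pos: "norm x + 1 > 0" by (simp add: add_nonneg_pos)
    then obtain M where M: "\<forall>m\<ge>M. \<forall>n\<ge>M. norm (X m - X n) < e / (norm x + 1)"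
      using C[of "e / (norm x + 1)"] e by auto
    have "dist (X m *\<^sub>V x) (X n *\<^sub>V x) < e" if "m \<ge> M" "n \<ge> M" for m n
    proof -
      have "dist (X m *\<^sub>V x) (X n *\<^sub>V x) \<le> norm (X m - X n) * norm x"
        using norm_cblinfun_apply[of "X m - X n" x] by (simp add: dist_norm cblinfun.diff_left)
      also have "\<dots> \<le> norm (X m - X n) * (norm x + 1)" by (intro mult_left_mono) auto
      also have "\<dots> < e" using M that pos by (simp add: pos_less_divide_eq)
      finally show ?thesis .
    qed
    then show "\<exists>M. \<forall>m\<ge>M. \<forall>n\<ge>M. dist (X m *\<^sub>V x) (X n *\<^sub>V x) < e" by blast
  qed
  then have "\<exists>y. (\<lambda>n. X n *\<^sub>V x) \<longlonglongrightarrow> y" for x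
    using Cauchy_convergent convergent_def by blast
  then obtain f where f: "\<And>x. (\<lambda>n. X n *\<^sub>V x) \<longlonglongrightarrow> f x" by metis
  have add: "f (x + y) = f x + f y" for x y
    by (rule LIMSEQ_unique[OF f]) (simp add: cblinfun.add_right tendsto_add f)
  have scale: "f (c *\<^sub>C x) = c *\<^sub>C f x" for c x
    by (rule LIMSEQ_unique[OF f])
      (simp add: cblinfun_apply_scaleC bounded_linear.tendsto[OF bounded_linear_scaleC] f)
  \<comment> \<open>Letting m tend to infinity in the Cauchy estimate gives a bound uniform in x; it
    yields the boundedness of f and then convergence in operator norm.\<close>
  have close: "norm (X n *\<^sub>V x - f x) \<le> e * norm x"
    if "\<forall>m\<ge>M. \<forall>n\<ge>M. norm (X m - X n) < e" "n \<ge> M" for M n e x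
  proof (rule tendsto_upperbound)
    show "(\<lambda>m. norm (X n *\<^sub>V x - X m *\<^sub>V x)) \<longlonglongrightarrow> norm (X n *\<^sub>V x - f x)"
      by (intro tendsto_intros f)
    have "norm (X n *\<^sub>V x - X m *\<^sub>V x) \<le> e * norm x" if "m \<ge> M" for m
      using norm_cblinfun_apply[of "X n - X m" x] \<open>\<forall>m\<ge>M. \<forall>n\<ge>M. norm (X m - X n) < e\<close> that \<open>n \<ge> M\<close>
      by (smt (verit, ccfv_SIG) cblinfun.diff_left mult_right_mono norm_ge_zero)
    then show "\<forall>\<^sub>F m in sequentially. norm (X n *\<^sub>V x - X m *\<^sub>V x) \<le> e * norm x"
      by (auto simp: eventually_sequentially)
  qed simp
  have "bounded_linear f"
  proof -
    obtain M where M: "\<forall>m\<ge>M. \<forall>n\<ge>M. norm (X m - X n) < 1" using C[of 1] by auto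
    show ?thesis
    proof (rule bounded_linear_intro)
      show "f (r *\<^sub>R x) = r *\<^sub>R f x" for r x by (metis scale scaleC_of_real)
      show "norm (f x) \<le> norm x * (1 + norm (X M))" for x
        using close[OF M, of M x] norm_cblinfun_apply[of "X M" x]
          norm_triangle_ineq2[of "f x" "X M *\<^sub>V x"]
        by (simp add: norm_minus_commute algebra_simps)
    qed (rule add)
  qed
  then obtain T where T: "\<And>x. T *\<^sub>V x = f x"
    using ex_cblinfun scale by blast
  have "X \<longlonglongrightarrow> T"
  proof (rule metric_LIMSEQ_I)
    fix e :: real assume e: "e > 0"
    then obtain M where M: "\<forall>m\<ge>M. \<forall>n\<ge>M. norm (X m - X n) < e / 2" using C[of "e / 2"] by auto
    have "norm (X n - T) \<le> e / 2" if "n \<ge> M" for n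
      by (rule norm_cblinfun_bound) (use close[OF M that] e in \<open>auto simp: cblinfun.diff_left T\<close>)
    then have "\<forall>n\<ge>M. dist (X n) T < e"
      using e by (fastforce simp: dist_norm)
    then show "\<exists>M. \<forall>n\<ge>M. dist (X n) T < e" by blast
  qed
  then show "convergent X" by (rule convergentI)
qed

section \<open>Inner products, orthogonal projection and the Lax-Milgram lemma\<close>

lemma cinner_add_right: "cinner x (y + z) = cinner x y + cinner x z"
  by (metis cinner_add_left cinner_commute complex_cnj_add)

lemma cinner_scaleC_right: "cinner x (a *\<^sub>C y) = cnj a * cinner x y"
  by (metis cinner_scaleC_left cinner_commute complex_cnj_mult)

lemma cinner_minus_left: "cinner (- x) y = - cinner x y"
  using cinner_scaleC_left[of "-1" x y] scaleC.minus_left[of 1 x] by simp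

lemma cinner_minus_right: "cinner x (- y) = - cinner x y"
  by (metis cinner_minus_left cinner_commute complex_cnj_minus)

lemma cinner_diff_left: "cinner (x - y) z = cinner x z - cinner y z"
  using cinner_add_left[of x "- y" z] by (simp add: cinner_minus_left)

lemma cinner_diff_right: "cinner x (y - z) = cinner x y - cinner x z"
  using cinner_add_right[of x y "- z"] by (simp add: cinner_minus_right)

lemma cinner_zero_left [simp]: "cinner 0 x = 0"
  using cinner_diff_left[of 0 0 x] by simp

lemma cinner_zero_right [simp]: "cinner x 0 = 0"
  using cinner_diff_right[of x 0 0] by simp

text \<open>Pythagoras for the projection onto the line spanned by y. Nonnegativity of the left-hand
  side is the Cauchy-Schwarz inequality; for a vector of minimal distance the subtracted square must
  vanish.\<close>

lemma norm_diff_projection: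
  assumes "y \<noteq> 0"
  shows "(norm (x - (cinner x y / (norm y)\<^sup>2) *\<^sub>C y))\<^sup>2 = (norm x)\<^sup>2 - (cmod (cinner x y) / norm y)\<^sup>2"
proof -
  define c where "c = cinner x y / complex_of_real ((norm y)\<^sup>2)"
  have c: "c * complex_of_real ((norm y)\<^sup>2) = cinner x y" using assms by (simp add: c_def)
  have "complex_of_real ((norm (x - c *\<^sub>C y))\<^sup>2)
      = cinner x x - cnj c * cinner x y - c * cnj (cinner x y) + c * cnj c * cinner y y"
    unfolding cinner_self[symmetric] cinner_diff_left cinner_diff_right
      cinner_scaleC_left cinner_scaleC_right
    by (simp add: algebra_simps flip: cinner_commute)
  also have "\<dots> = cinner x x - cnj c * cinner x y"
    using c by (simp add: cinner_self) (metis complex_cnj_complex_of_real complex_cnj_mult mult.assoc of_real_power mult.commute)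
  also have "cnj c * cinner x y = complex_of_real ((cmod (cinner x y) / norm y)\<^sup>2)"
    by (simp add: c_def power_divide complex_norm_square[symmetric] mult.commute)
  finally have "complex_of_real ((norm (x - c *\<^sub>C y))\<^sup>2)
     = complex_of_real ((norm x)\<^sup>2 - (cmod (cinner x y) / norm y)\<^sup>2)"
    by (simp add: cinner_self)
  then show ?thesis unfolding c_def of_real_eq_iff by simp
qed

lemma cinner_Cauchy_Schwarz: "cmod (cinner x y) \<le> norm x * norm y"
proof (cases "y = 0")
  case False
  have "(cmod (cinner x y) / norm y)\<^sup>2 \<le> (norm x)\<^sup>2"
    using norm_diff_projection[OF False, of x] by (metis diff_ge_0_iff_ge zero_le_power2)
  then have "cmod (cinner x y) / norm y \<le> norm x" by (rule power2_le_imp_le) simp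
  then show ?thesis using False by (simp add: divide_le_eq)
qed simp

lemma parallelogram_law:
  fixes x y :: "'a::complex_hilbert"
  shows "(norm (x + y))\<^sup>2 + (norm (x - y))\<^sup>2 = 2 * (norm x)\<^sup>2 + 2 * (norm y)\<^sup>2"
proof -
  have "complex_of_real ((norm (x + y))\<^sup>2 + (norm (x - y))\<^sup>2)
     = complex_of_real (2 * (norm x)\<^sup>2 + 2 * (norm y)\<^sup>2)"
    by (simp only: of_real_add of_real_mult cinner_self[symmetric])
      (simp add: cinner_add_left cinner_add_right cinner_diff_left cinner_diff_right)
  then show ?thesis unfolding of_real_eq_iff .
qed

text \<open>A minimizing sequence for the distance from y to S is Cauchy by the parallelogram law;
  its limit p lies in S, and minimality makes \<open>y - p\<close> orthogonal to S.\<close>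

lemma ex_orthogonal_to_closed_subspace:
  fixes S :: "'a::complex_hilbert set"
  assumes "closed S" "0 \<in> S" and add: "\<And>x y. x \<in> S \<Longrightarrow> y \<in> S \<Longrightarrow> x + y \<in> S"
    and scale: "\<And>c x. x \<in> S \<Longrightarrow> c *\<^sub>C x \<in> S" and y: "y \<notin> S"
  shows "\<exists>w. w \<noteq> 0 \<and> (\<forall>s\<in>S. cinner w s = 0)"
proof -
  define d where "d = infdist y S"
  have "S \<noteq> {}" using assms by auto
  have d0: "d \<ge> 0" by (simp add: d_def infdist_nonneg)
  have ge: "d \<le> norm (y - s)" if "s \<in> S" for s
    using infdist_le[OF that, of y] by (simp add: d_def dist_norm)
  have "\<exists>s\<in>S. norm (y - s) < d + e" if "e > 0" for e
  proof -
    have "Inf (dist y ` S) < d + e" using that \<open>S \<noteq> {}\<close> by (simp add: d_def infdist_def)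
    then show ?thesis using cInf_lessD[of "dist y ` S" "d + e"] \<open>S \<noteq> {}\<close> by (auto simp: dist_norm)
  qed
  then have "\<forall>n. \<exists>s\<in>S. norm (y - s) < d + inverse (real (Suc n))" by simp
  then obtain s where s: "\<And>n. s n \<in> S" "\<And>n. norm (y - s n) < d + inverse (real (Suc n))" by metis
  have close: "(norm (s m - s n))\<^sup>2 \<le> 4 * (d + inverse (real (Suc N)))\<^sup>2 - 4 * d\<^sup>2"
    if "m \<ge> N" "n \<ge> N" for m n N
  proof -
    have le: "(norm (y - s k))\<^sup>2 \<le> (d + inverse (real (Suc N)))\<^sup>2" if "k \<ge> N" for k
    proof (rule power_mono)
      have "inverse (real (Suc k)) \<le> inverse (real (Suc N))" using that by (intro le_imp_inverse_le) auto
      then show "norm (y - s k) \<le> d + inverse (real (Suc N))" using s(2)[of k] by linarith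
    qed simp
    \<comment> \<open>The midpoint belongs to S, so its distance from y is at least d; this is the
      lower bound that enters the parallelogram law.\<close>
    define h where "h = (1/2) *\<^sub>R (s m + s n)"
    have "h \<in> S" unfolding h_def using add[OF s(1) s(1)] scale scaleC_of_real by metis
    have "(y - s m) + (y - s n) = 2 *\<^sub>R (y - h)" by (simp add: h_def algebra_simps scaleR_2)
    then have "norm ((y - s m) + (y - s n)) = 2 * norm (y - h)" by simp
    moreover have "(norm (y - h))\<^sup>2 \<ge> d\<^sup>2" using ge[OF \<open>h \<in> S\<close>] d0 by (simp add: power_mono)
    ultimately have "(norm ((y - s m) + (y - s n)))\<^sup>2 \<ge> 4 * d\<^sup>2" by (simp add: power_mult_distrib)
    moreover have "(y - s m) - (y - s n) = s n - s m" by simp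
    ultimately show ?thesis
      using parallelogram_law[of "y - s m" "y - s n"] le[OF that(1)] le[OF that(2)]
      by (simp add: norm_minus_commute)
  qed
  have "Cauchy s"
  proof (rule metric_CauchyI)
    fix e :: real assume "e > 0"
    have "(\<lambda>N. 4 * (d + inverse (real (Suc N)))\<^sup>2 - 4 * d\<^sup>2) \<longlonglongrightarrow> 4 * (d + 0)\<^sup>2 - 4 * d\<^sup>2"
      by (intro tendsto_intros LIMSEQ_inverse_real_of_nat)
    then have "\<forall>\<^sub>F N in sequentially. 4 * (d + inverse (real (Suc N)))\<^sup>2 - 4 * d\<^sup>2 < e\<^sup>2"
      by (rule order_tendstoD) (use \<open>e > 0\<close> in simp)
    then obtain N where N: "4 * (d + inverse (real (Suc N)))\<^sup>2 - 4 * d\<^sup>2 < e\<^sup>2"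
      by (auto simp: eventually_sequentially)
    have "dist (s m) (s n) < e" if "m \<ge> N" "n \<ge> N" for m n
    proof (rule power2_less_imp_less)
      show "(dist (s m) (s n))\<^sup>2 < e\<^sup>2" using close[OF that] N by (simp add: dist_norm)
    qed (use \<open>e > 0\<close> in simp)
    then show "\<exists>N. \<forall>m\<ge>N. \<forall>n\<ge>N. dist (s m) (s n) < e" by blast
  qed
  then obtain p where p: "s \<longlonglongrightarrow> p" using Cauchy_convergent convergent_def by blast
  have "p \<in> S" using closed_sequentially[OF \<open>closed S\<close> _ p] s(1) by blast
  have "norm (y - p) \<le> d + 0"
  proof (rule tendsto_le)
    show "(\<lambda>n. norm (y - s n)) \<longlonglongrightarrow> norm (y - p)" by (intro tendsto_intros p)
    show "(\<lambda>n. d + inverse (real (Suc n))) \<longlonglongrightarrow> d + 0"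
      by (intro tendsto_intros LIMSEQ_inverse_real_of_nat)
    show "\<forall>\<^sub>F n in sequentially. norm (y - s n) \<le> d + inverse (real (Suc n))"
      using s(2) by (auto simp: less_imp_le)
  qed simp
  define w where "w = y - p"
  have min: "norm w \<le> norm (w - u)" if "u \<in> S" for u
    using ge[OF add[OF \<open>p \<in> S\<close> that]] \<open>norm (y - p) \<le> d + 0\<close> by (simp add: w_def algebra_simps)
  have "cinner w u = 0" if "u \<in> S" for u
  proof (cases "u = 0")
    case False
    \<comment> \<open>Subtracting the component along u moves w only within \<open>w - S\<close>, so
      it cannot shorten w.\<close>
    have "(norm w)\<^sup>2 \<le> (norm w)\<^sup>2 - (cmod (cinner w u) / norm u)\<^sup>2"
      unfolding norm_diff_projection[OF False, symmetric]
      using min[OF scale[OF that]] by (intro power_mono) auto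
    then have "(cmod (cinner w u) / norm u)\<^sup>2 = 0"
      by (smt (verit) zero_le_power2)
    then show ?thesis using False by simp
  qed simp
  moreover have "w \<noteq> 0" using y \<open>p \<in> S\<close> by (auto simp: w_def)
  ultimately show ?thesis by blast
qed

text \<open>Coercivity gives \<open>m * norm x \<le> norm (T *\<^sub>V x)\<close>, hence
  injectivity, a closed range and the bound of the inverse. A nonzero w orthogonal to the range
  would be orthogonal to its own image, against coercivity at w.\<close>

theorem Lax_Milgram:
  fixes T :: "'a::complex_hilbert \<Rightarrow>\<^sub>C\<^sub>L 'a"
  assumes m: "m > 0" and coercive: "\<And>x. m * (norm x)\<^sup>2 \<le> cmod (cinner (T *\<^sub>V x) x)"
  obtains R :: "'a \<Rightarrow>\<^sub>C\<^sub>L 'a" where "R o\<^sub>C\<^sub>L T = id_cblinfun" "T o\<^sub>C\<^sub>L R = id_cblinfun" "norm R \<le> 1 / m"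
proof -
  have below: "m * norm x \<le> norm (T *\<^sub>V x)" for x
  proof (cases "x = 0")
    case False
    have "m * norm x * norm x \<le> norm (T *\<^sub>V x) * norm x"
      using coercive[of x] cinner_Cauchy_Schwarz[of "T *\<^sub>V x" x]
      by (simp add: power2_eq_square mult.assoc)
    then show ?thesis using False by simp
  qed simp
  have inj: "x = y" if "T *\<^sub>V x = T *\<^sub>V y" for x y
    using below[of "x - y"] that m
    by (simp add: cblinfun.diff_right) (smt (verit) mult_pos_pos zero_less_norm_iff eq_iff_diff_eq_0)
  have "complete (range (cblinfun_apply T))"
  proof (rule complete_isometric_image[OF m])
    show "bounded_linear (cblinfun_apply T)" by (rule cblinfun.bounded_linear_right)
    show "\<forall>x\<in>UNIV. norm (T *\<^sub>V x) \<ge> m * norm x" using below by blast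
  qed (auto simp: complete_UNIV)
  then have "closed (range (cblinfun_apply T))" by (rule complete_imp_closed)
  have surj: "y \<in> range (cblinfun_apply T)" for y
  proof (rule ccontr)
    assume "y \<notin> range (cblinfun_apply T)"
    then have "\<exists>w. w \<noteq> 0 \<and> (\<forall>s\<in>range (cblinfun_apply T). cinner w s = 0)"
    proof (rule ex_orthogonal_to_closed_subspace[rotated -1])
      show "0 \<in> range (cblinfun_apply T)" using cblinfun.zero_right[of T] by (metis rangeI)
      show "u + v \<in> range (cblinfun_apply T)"
        if "u \<in> range (cblinfun_apply T)" "v \<in> range (cblinfun_apply T)" for u v
        using that by (auto simp flip: cblinfun.add_right)
      show "c *\<^sub>C u \<in> range (cblinfun_apply T)" if "u \<in> range (cblinfun_apply T)" for c u
        using that by (auto simp flip: cblinfun_apply_scaleC)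
    qed fact
    then obtain w where "w \<noteq> 0" "cinner w (T *\<^sub>V w) = 0" by blast
    then have "cinner (T *\<^sub>V w) w = 0" by (metis cinner_commute complex_cnj_zero)
    then show False using coercive[of w] \<open>w \<noteq> 0\<close> m by (simp add: mult_le_0_iff)
  qed
  define f where "f = inv (cblinfun_apply T)"
  have f: "T *\<^sub>V f y = y" for y
    unfolding f_def by (rule f_inv_into_f) (rule surj)
  have bound: "norm (f y) \<le> norm y * (1 / m)" for y
    using below[of "f y"] m by (simp add: f field_simps)
  have "bounded_linear f"
  proof (rule bounded_linear_intro)
    show "f (x + y) = f x + f y" for x y by (rule inj) (simp add: f cblinfun.add_right)
    show "f (r *\<^sub>R x) = r *\<^sub>R f x" for r x by (rule inj) (simp add: f cblinfun.scaleR_right)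
  qed (rule bound)
  moreover have "f (c *\<^sub>C x) = c *\<^sub>C f x" for c x
    by (rule inj) (simp add: f cblinfun_apply_scaleC)
  ultimately obtain R where R: "\<And>y. R *\<^sub>V y = f y" using ex_cblinfun by blast
  show thesis
  proof
    show "R o\<^sub>C\<^sub>L T = id_cblinfun" by (rule cblinfun_eqI) (simp add: R inj f)
    show "T o\<^sub>C\<^sub>L R = id_cblinfun" by (rule cblinfun_eqI) (simp add: R f)
    show "norm R \<le> 1 / m"
      by (rule norm_cblinfun_bound) (use m bound in \<open>auto simp: R mult.commute\<close>)
  qed
qed

lemma cblinfun_inv_eqI:
  assumes "R o\<^sub>C\<^sub>L T = id_cblinfun" "T o\<^sub>C\<^sub>L R = id_cblinfun"
  shows "cblinfun_inv T = R"
  unfolding cblinfun_inv_def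
proof (rule the_equality)
  fix S assume S: "S o\<^sub>C\<^sub>L T = id_cblinfun \<and> T o\<^sub>C\<^sub>L S = id_cblinfun"
  show "S = R"
  proof (rule cblinfun_eqI)
    fix x
    have "S *\<^sub>V x = S *\<^sub>V T *\<^sub>V R *\<^sub>V x" using arg_cong[OF assms(2), of "\<lambda>U. U *\<^sub>V x"] by simp
    also have "\<dots> = R *\<^sub>V x" using arg_cong[OF conjunct1[OF S], of "\<lambda>U. U *\<^sub>V (R *\<^sub>V x)"] by simp
    finally show "S *\<^sub>V x = R *\<^sub>V x" .
  qed
qed (use assms in simp)

section \<open>Arc length\<close>

text \<open>Tagging every interval with its left end point yields a tagged division, for which the
  sum telescopes.\<close>

lemma additive_division_1:
  fixes f :: "real \<Rightarrow> 'a::real_normed_vector"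
  assumes "a \<le> b" "p division_of {a..b}"
  shows "(\<Sum>k\<in>p. f (Sup k) - f (Inf k)) = f b - f a"
proof -
  note p = division_ofD[OF assms(2)]
  have tag: "(\<lambda>k. (Inf k, k)) ` p tagged_division_of {a..b}"
  proof (rule tagged_division_ofI)
    fix x k assume "(x, k) \<in> (\<lambda>k. (Inf k, k)) ` p"
    then have k: "x = Inf k" "k \<in> p" by auto
    from p(4)[OF k(2)] p(3)[OF k(2)] obtain u v where uv: "k = {u..v}" "u \<le> v" by auto
    show "x \<in> k" "\<exists>a b. k = cbox a b" "k \<subseteq> {a..b}" using uv k p(2)[OF k(2)] by auto
  next
    fix x1 k1 x2 k2
    assume "(x1, k1) \<in> (\<lambda>k. (Inf k, k)) ` p" "(x2, k2) \<in> (\<lambda>k. (Inf k, k)) ` p" "(x1, k1) \<noteq> (x2, k2)"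
    then show "interior k1 \<inter> interior k2 = {}" by (intro p(5)) auto
  next
    show "\<Union>{k. \<exists>x. (x, k) \<in> (\<lambda>k. (Inf k, k)) ` p} = {a..b}" using p(6) by (auto simp: image_iff)
  qed (use p(1) in auto)
  have "(\<Sum>(x, k)\<in>(\<lambda>k. (Inf k, k)) ` p. f (Sup k) - f (Inf k)) = (\<Sum>k\<in>p. f (Sup k) - f (Inf k))"
    by (subst sum.reindex) (auto simp: inj_on_def)
  then show ?thesis using additive_tagged_division_1[OF assms(1) tag, of f] by simp
qed

lemma division_of_real_interval:
  assumes "p division_of {a..b::real}" "k \<in> p"
  obtains u v where "k = {u..v}" "a \<le> u" "u \<le> v" "v \<le> b"
proof -
  obtain u v where "k = {u..v}" "k \<noteq> {}" "k \<subseteq> {a..b}"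
    using division_ofD(2-4)[OF assms] by auto
  then show thesis using that by auto
qed

lemma tagged_division_of_real_interval:
  assumes "p tagged_division_of {a..b::real}" "(x, k) \<in> p"
  obtains u v where "k = {u..v}" "a \<le> u" "u \<le> x" "x \<le> v" "v \<le> b"
proof -
  obtain u v where "k = {u..v}" "x \<in> k" "k \<subseteq> {a..b}"
    using tagged_division_ofD(2-4)[OF assms] by auto
  then show thesis using that by auto
qed

abbreviation variation_sum :: "(real \<Rightarrow> complex) \<Rightarrow> real set set \<Rightarrow> real" where
  "variation_sum g p \<equiv> \<Sum>k\<in>p. cmod (g (Sup k) - g (Inf k))"

text \<open>Appending one interval is the source of the superadditivity of arc length and of its
  boundedness on initial pieces.\<close>

lemma extend_division_right:
  assumes p: "p division_of {0..s}" and st: "0 \<le> s" "s < t"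
  shows "insert {s..t} p division_of {0..t}"
    "variation_sum g (insert {s..t} p) = variation_sum g p + cmod (g t - g s)"
proof -
  have "{{s..t}} division_of {s..t}" using st division_of_self[of s t] by simp
  then have "p \<union> {{s..t}} division_of {0..s} \<union> {s..t}"
    by (rule division_disjoint_union[OF p]) auto
  moreover have "{0..s} \<union> {s..t} = {0..t}" using st by auto
  ultimately show "insert {s..t} p division_of {0..t}" by simp
  have "{s..t} \<notin> p"
  proof
    assume "{s..t} \<in> p"
    then have "{s..t} \<subseteq> {0..s}" using division_ofD(2)[OF p] by blast
    then show False using st by auto
  qed
  then show "variation_sum g (insert {s..t} p) = variation_sum g p + cmod (g t - g s)"
    using st division_ofD(1)[OF p] by simp
qed

lemma arc_length_less_0: "t < 0 \<Longrightarrow> arc_length g t = 0"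
  by (simp add: arc_length_def)

lemma arc_length_0: "arc_length g 0 = 0"
proof -
  have "variation_sum g p = 0" if p: "p division_of {0..0}" for p
  proof (intro sum.neutral ballI)
    fix k assume "k \<in> p"
    then obtain u v where "k = {u..v}" "0 \<le> u" "u \<le> v" "v \<le> 0"
      using division_of_real_interval[OF p] by metis
    moreover from this have "u = 0" "v = 0" by auto
    ultimately show "cmod (g (Sup k) - g (Inf k)) = 0" by simp
  qed
  moreover have "{{0..0}} division_of {0..0::real}" using division_of_self[of "0::real" 0] by simp
  ultimately have "(\<lambda>p. variation_sum g p) ` {p. p division_of {0..0}} = {0}"
    by (simp add: image_constant_conv) blast
  then have "{variation_sum g p | p. p division_of {0..0}} = {0}"
    by (simp add: setcompr_eq_image)
  then show ?thesis by (simp add: arc_length_def)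
qed

context
  fixes g :: "real \<Rightarrow> complex"
  assumes rect: "rectifiable g"
begin

text \<open>A division of \<open>[0, t]\<close> completed by \<open>[t, 1]\<close> is one of the
  whole arc, so the bound provided by \<open>rectifiable\<close> works for every t.\<close>

lemma bdd_above_variation_sums: "bdd_above {variation_sum g p | p. p division_of {0..min t 1}}"
proof -
  obtain M where M: "\<And>p. p division_of {0..1} \<Longrightarrow> variation_sum g p \<le> M"
    using rect unfolding rectifiable_def bdd_above_def by blast
  consider "t < 0" | "0 \<le> t" "t < 1" | "t \<ge> 1" by linarith
  then show ?thesis
  proof cases
    case 2
    have "variation_sum g p \<le> M" if "p division_of {0..min t 1}" for p
    proof -
      have p: "p division_of {0..t}" using that 2 by simp
      have "variation_sum g p + cmod (g 1 - g t) \<le> M"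
        using M[OF extend_division_right(1)[OF p 2]] extend_division_right(2)[OF p 2] by simp
      then show ?thesis using norm_ge_zero[of "g 1 - g t"] by linarith
    qed
    then show ?thesis by (auto intro!: bdd_aboveI[of _ M])
  next
    case 3
    then show ?thesis using M by (auto intro!: bdd_aboveI[of _ M])
  qed auto
qed

lemma variation_sum_le_arc_length:
  "t \<le> 1 \<Longrightarrow> p division_of {0..t} \<Longrightarrow> variation_sum g p \<le> arc_length g t"
  unfolding arc_length_def using bdd_above_variation_sums[of t] by (intro cSup_upper) auto

lemma ex_division_of_real: "\<exists>p. p division_of {0..t::real}"
  using elementary_interval[of 0 t] by auto

text \<open>Every division of \<open>[0, s]\<close>, extended by \<open>[s, t]\<close>, competes in
  the supremum for t. With arc length as \<open>\<rho>\<close>, this is the domination of increments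
  on which the integration lemmas rest.\<close>

lemma norm_diff_le_arc_length:
  assumes "0 \<le> s" "s \<le> t" "t \<le> 1"
  shows "cmod (g t - g s) \<le> arc_length g t - arc_length g s"
proof (cases "s = t")
  case False
  have "arc_length g s \<le> arc_length g t - cmod (g t - g s)"
    unfolding arc_length_def[of g s]
  proof (rule cSup_least)
    show "{variation_sum g p |p. p division_of {0..min s 1}} \<noteq> {}"
      using ex_division_of_real by blast
    fix z assume "z \<in> {variation_sum g p |p. p division_of {0..min s 1}}"
    then obtain p where p: "z = variation_sum g p" "p division_of {0..s}" using assms by auto
    have "s < t" using False assms by simp
    then show "z \<le> arc_length g t - cmod (g t - g s)"
      using variation_sum_le_arc_length[OF assms(3) extend_division_right(1)[OF p(2) assms(1)]]
        extend_division_right(2)[OF p(2) assms(1), of t g] p(1) by simp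
  qed
  then show ?thesis by simp
qed simp

text \<open>\<open>interval_measure\<close> works with functions on the whole line; the constant
  extension reduces monotonicity and continuity there to \<open>[0, 1]\<close>.\<close>

lemma arc_length_clip: "arc_length g t = arc_length g (max 0 (min 1 t))"
proof -
  consider "t < 0" | "0 \<le> t" "t \<le> 1" | "t > 1" by linarith
  then show ?thesis
    by cases (auto simp: arc_length_less_0 arc_length_0, simp add: arc_length_def)
qed

lemma mono_arc_length: "s \<le> t \<Longrightarrow> arc_length g s \<le> arc_length g t"
  unfolding arc_length_clip[of s] arc_length_clip[of t]
  using norm_diff_le_arc_length[of "max 0 (min 1 s)" "max 0 (min 1 t)"] norm_ge_zero[of "_ :: complex"]
  by (smt (verit))

text \<open>Every variation sum, cut off at \<open>t\<close>, is a continuous function of \<open>t\<close>, and the arc length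
  exceeds it by a nondecreasing function of \<open>t\<close>; so the arc length is a uniform limit of
  continuous functions.\<close>

lemma continuous_arc_length:
  assumes g: "continuous_on {0..1} g"
  shows "continuous (at_right t) (arc_length g)"
proof -
  \<comment> \<open>The part of the variation sum lying in \<open>[0, t]\<close>: intervals beyond t
    contribute 0, and one containing t is cut there.\<close>
  define h where "h p t = (\<Sum>k\<in>p. cmod (g (min (Sup k) t) - g (min (Inf k) t)))" for p t
  have h_incr: "h p t - h p s \<le> arc_length g t - arc_length g s"
    if p: "p division_of {0..1}" and st: "0 \<le> s" "s \<le> t" "t \<le> 1" for p s t
  proof -
    \<comment> \<open>Arc length clamped to \<open>[s, t]\<close>, so that its increments over p
      telescope to the increment from s to t alone.\<close>
    let ?c = "\<lambda>u. arc_length g (max s (min t u))"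
    have "h p t - h p s \<le> (\<Sum>k\<in>p. ?c (Sup k) - ?c (Inf k))"
      unfolding h_def sum_subtractf[symmetric]
    proof (rule sum_mono)
      fix k assume "k \<in> p"
      then obtain u v where k: "k = {u..v}" "0 \<le> u" "u \<le> v" "v \<le> 1"
        using division_of_real_interval[OF p] by metis
      consider "v \<le> s" | "u \<le> s" "s \<le> v" | "s \<le> u" by linarith
      then show "cmod (g (min (Sup k) t) - g (min (Inf k) t)) - cmod (g (min (Sup k) s) - g (min (Inf k) s))
          \<le> ?c (Sup k) - ?c (Inf k)"
      proof cases
        case 1
        then have "min v s = v" "min u s = u" "min v t = v" "min u t = u"
          "max s (min t u) = s" "max s (min t v) = s"
          using k st by auto
        then show ?thesis using k by simp
      next
        case 2
        then have m: "min v s = s" "min u s = u" "min u t = u" "max s (min t u) = s"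
          "max s (min t v) = min v t" "s \<le> min v t" "min v t \<le> 1"
          using k st by auto
        \<comment> \<open>The interval straddles s; the triangle inequality through
          \<open>g s\<close> removes the part before s.\<close>
        have "cmod (g (min v t) - g u) - cmod (g s - g u) \<le> cmod (g (min v t) - g s)"
          using norm_triangle_ineq[of "g (min v t) - g s" "g s - g u"] by simp
        also have "\<dots> \<le> arc_length g (min v t) - arc_length g s"
          using norm_diff_le_arc_length st m by blast
        finally show ?thesis using k m by simp
      next
        case 3
        then have m: "min v s = s" "min u s = s" "max s (min t u) = min u t"
          "max s (min t v) = min v t"
          using k st by auto
        have "cmod (g (min v t) - g (min u t)) \<le> arc_length g (min v t) - arc_length g (min u t)"
          by (rule norm_diff_le_arc_length) (use k st in auto)
        then show ?thesis using k m by simp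
      qed
    qed
    also have "\<dots> = arc_length g t - arc_length g s"
      by (subst additive_division_1[OF _ p]) (use st in auto)
    finally show ?thesis .
  qed
  have h0: "h p 0 = 0" if p: "p division_of {0..1}" for p
    unfolding h_def
  proof (intro sum.neutral ballI)
    fix k assume "k \<in> p"
    then obtain u v where "k = {u..v}" "0 \<le> u" "u \<le> v" "v \<le> 1"
      using division_of_real_interval[OF p] by metis
    then show "cmod (g (min (Sup k) 0) - g (min (Inf k) 0)) = 0" by simp
  qed
  have h1: "h p 1 = variation_sum g p" if p: "p division_of {0..1}" for p
    unfolding h_def
  proof (rule sum.cong)
    fix k assume "k \<in> p"
    then obtain u v where k: "k = {u..v}" "0 \<le> u" "u \<le> v" "v \<le> 1"
      using division_of_real_interval[OF p] by metis
    then show "cmod (g (min (Sup k) 1) - g (min (Inf k) 1)) = cmod (g (Sup k) - g (Inf k))"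
      by (simp add: min_absorb1)
  qed simp
  have h_cont: "continuous_on {0..1} (h p)" if p: "p division_of {0..1}" for p
    unfolding h_def
  proof (intro continuous_intros continuous_on_compose2[OF g])
    fix k assume "k \<in> p"
    then obtain u v where k: "k = {u..v}" "0 \<le> u" "u \<le> v" "v \<le> 1"
      using division_of_real_interval[OF p] by metis
    then show "(\<lambda>t. min (Sup k) t) ` {0..1} \<subseteq> {0..1}" "(\<lambda>t. min (Inf k) t) ` {0..1} \<subseteq> {0..1}" by auto
  qed
  have "\<exists>p. p division_of {0..1} \<and> variation_sum g p > arc_length g 1 - inverse (real (Suc n))" for n
  proof -
    have "arc_length g 1 - inverse (real (Suc n)) < Sup {variation_sum g p | p. p division_of {0..min 1 1}}"
      by (simp add: arc_length_def)
    then show ?thesis using ex_division_of_real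
      by (subst (asm) less_cSup_iff[OF _ bdd_above_variation_sums]) auto
  qed
  then obtain p where p: "\<And>n. p n division_of {0..1}"
    "\<And>n. variation_sum g (p n) > arc_length g 1 - inverse (real (Suc n))" by metis
  \<comment> \<open>\<open>h_incr\<close> on \<open>[0, t]\<close> shows that h stays below the arc
    length; on \<open>[t, 1]\<close> it shows that the gap at t is at most the gap at 1.\<close>
  have close: "\<bar>h (p n) t - arc_length g t\<bar> \<le> inverse (real (Suc n))" if "t \<in> {0..1}" for n t
    using h_incr[OF p(1), of 0 t n] h_incr[OF p(1), of t 1 n] h0[OF p(1), of n] h1[OF p(1), of n] p(2)[of n] that
    by (simp add: arc_length_0)
  have "continuous_on {0..1} (arc_length g)"
  proof (rule uniform_limit_theorem)
    show "\<forall>\<^sub>F n in sequentially. continuous_on {0..1} (h (p n))" using h_cont p(1) by simp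
    show "uniform_limit {0..1} (\<lambda>n. h (p n)) (arc_length g) sequentially"
    proof (rule uniform_limitI)
      fix e :: real assume "e > 0"
      then have "\<forall>\<^sub>F n in sequentially. inverse (real (Suc n)) < e"
        by (rule order_tendstoD[OF LIMSEQ_inverse_real_of_nat])
      then show "\<forall>\<^sub>F n in sequentially. \<forall>t\<in>{0..1}. dist (h (p n) t) (arc_length g t) < e"
        by eventually_elim (auto simp: dist_real_def intro: le_less_trans[OF close])
    qed
  qed simp
  then have "continuous_on UNIV (\<lambda>t. arc_length g (max 0 (min 1 t)))"
    by (rule continuous_on_compose2) (auto intro!: continuous_intros)
  then have "continuous_on UNIV (arc_length g)"
    by (simp flip: arc_length_clip)
  then show ?thesis
    by (simp add: continuous_on_eq_continuous_at continuous_at_imp_continuous_within)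
qed

end

section \<open>Riemann--Stieltjes integrals\<close>

abbreviation stieltjes_sum ::
    "(real \<Rightarrow> complex) \<Rightarrow> (real \<Rightarrow> 'b::complex_normed_vector) \<Rightarrow> (real \<times> real set) set \<Rightarrow> 'b" where
  "stieltjes_sum g f p \<equiv> \<Sum>(t, k)\<in>p. (g (Sup k) - g (Inf k)) *\<^sub>C f t"

lemma division_filter_real_neq_bot: "division_filter {a..b::real} \<noteq> bot"
  using division_filter_not_empty[of a b] by simp

text \<open>One criterion serves the refinement of tagged divisions and the limits at the ends of
  the arc and of the ray.\<close>

lemma cauchy_filter_tendsto:
  fixes f :: "'a \<Rightarrow> 'b::complete_space"
  assumes "F \<noteq> bot"
    and "\<And>e. e > 0 \<Longrightarrow> \<exists>P. eventually P F \<and> (\<forall>x y. P x \<and> P y \<longrightarrow> dist (f x) (f y) < e)"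
  shows "\<exists>l. (f \<longlongrightarrow> l) F"
proof -
  have "cauchy_filter (filtermap f F)"
    using assms(2) by (simp add: cauchy_filter_metric_filtermap)
  then have "\<exists>l. filtermap f F \<le> nhds l"
    by (rule cauchy_filter_complete_converges[OF _ complete_UNIV])
      (use assms(1) in \<open>simp_all add: filtermap_bot_iff\<close>)
  then show ?thesis by (simp add: filterlim_def)
qed

lemma has_stieltjes_integralD:
  assumes "has_stieltjes_integral g F I a b" "e > 0"
  shows "\<exists>d. gauge d \<and> (\<forall>p. p tagged_division_of {a..b} \<and> d fine p \<longrightarrow>
    dist (stieltjes_sum g (\<lambda>t. F (g t)) p) I < e)"
  using tendstoD[OF assms[unfolded has_stieltjes_integral_def]]
  by (simp add: eventually_division_filter)

lemma has_stieltjes_integral_diff: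
  assumes "has_stieltjes_integral g F I a b" "has_stieltjes_integral g G J a b"
  shows "has_stieltjes_integral g (\<lambda>\<mu>. F \<mu> - G \<mu>) (I - J) a b"
  using tendsto_diff[OF assms[unfolded has_stieltjes_integral_def]]
  unfolding has_stieltjes_integral_def
  by (simp add: scaleC_diff_right case_prod_unfold flip: sum_subtractf)

text \<open>Fine divisions of the two subintervals unite to a fine division of the whole. As all
  three integrals are assumed to exist, one such division per tolerance suffices.\<close>

lemma has_stieltjes_integral_combine:
  assumes "a \<le> b" "b \<le> c"
    and I: "has_stieltjes_integral g F I a b" and J: "has_stieltjes_integral g F J b c"
    and L: "has_stieltjes_integral g F L a c"
  shows "L = I + J"
proof -
  let ?S = "stieltjes_sum g (\<lambda>t. F (g t))"
  have "dist L (I + J) \<le> e" if "e > 0" for e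
  proof -
    have e: "e / 3 > 0" using that by simp
    obtain d1 where d1: "gauge d1"
      "\<And>p. p tagged_division_of {a..b} \<Longrightarrow> d1 fine p \<Longrightarrow> dist (?S p) I < e / 3"
      using has_stieltjes_integralD[OF I e] by (elim exE conjE) auto
    obtain d2 where d2: "gauge d2"
      "\<And>p. p tagged_division_of {b..c} \<Longrightarrow> d2 fine p \<Longrightarrow> dist (?S p) J < e / 3"
      using has_stieltjes_integralD[OF J e] by (elim exE conjE) auto
    obtain d3 where d3: "gauge d3"
      "\<And>p. p tagged_division_of {a..c} \<Longrightarrow> d3 fine p \<Longrightarrow> dist (?S p) L < e / 3"
      using has_stieltjes_integralD[OF L e] by (elim exE conjE) auto
    obtain p where p: "p tagged_division_of {a..b}" "d1 fine p" "d3 fine p"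
      by (rule fine_division_exists_real[OF gauge_Int[OF d1(1) d3(1)], of a b]) (simp add: fine_Int)
    obtain q where q: "q tagged_division_of {b..c}" "d2 fine q" "d3 fine q"
      by (rule fine_division_exists_real[OF gauge_Int[OF d2(1) d3(1)], of b c]) (simp add: fine_Int)
    have "p \<union> q tagged_division_of {a..b} \<union> {b..c}"
      by (rule tagged_division_Un[OF p(1) q(1)]) auto
    then have pq: "p \<union> q tagged_division_of {a..c}" using assms(1,2) by (simp add: ivl_disj_un_two_touch)
    \<comment> \<open>A tagged interval common to both divisions is degenerate, with zero increment,
      so counting it once or twice makes no difference.\<close>
    have "?S (p \<union> q) = ?S p + ?S q"
    proof (rule sum.union_inter_neutral)
      show "\<forall>x\<in>p \<inter> q. (case x of (t, k) \<Rightarrow> (g (Sup k) - g (Inf k)) *\<^sub>C F (g t)) = 0"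
      proof clarify
        fix t k assume tk: "(t, k) \<in> p" "(t, k) \<in> q"
        from tagged_division_of_real_interval[OF p(1) tk(1)] obtain u v
          where k: "k = {u..v}" "u \<le> t" "t \<le> v" "v \<le> b" by metis
        have "k \<subseteq> {b..c}" using tagged_division_ofD(3)[OF q(1) tk(2)] .
        then have "u = v" using k by force
        then show "(g (Sup k) - g (Inf k)) *\<^sub>C F (g t) = 0" using k by (simp add: scaleC.zero_left)
      qed
    qed (use p q in auto)
    moreover have "dist (?S (p \<union> q)) L < e / 3" using d3(2)[OF pq] p q by (simp add: fine_Un)
    moreover have "dist (?S p + ?S q) (I + J) < e / 3 + e / 3"
      using dist_triangle_add[of "?S p" "?S q" I J] d1(2)[OF p(1,2)] d2(2)[OF q(1,2)] by linarith
    ultimately show ?thesis using dist_triangle2[of L "I + J" "?S (p \<union> q)"] by (simp add: dist_commute)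
  qed
  then have "dist L (I + J) \<le> 0" by (metis field_le_epsilon add_0)
  then show ?thesis by simp
qed

text \<open>The common refinement of two tagged divisions is encoded by cutting off \<open>g\<close>: for \<open>k\<close> and
  \<open>m\<close> intervals of the two divisions, \<open>cut_diff g k m\<close> is the increment of \<open>g\<close> over \<open>k \<inter> m\<close>,
  and \<open>0\<close> if that is empty.\<close>

definition cut_diff :: "(real \<Rightarrow> 'b::real_normed_vector) \<Rightarrow> real set \<Rightarrow> real set \<Rightarrow> 'b" where
  "cut_diff g k m =
     g (max (Inf k) (min (Sup k) (Sup m))) - g (max (Inf k) (min (Sup k) (Inf m)))"

text \<open>Both sides are the increment over the intersection, or 0 for disjoint intervals. The
  symmetry lets two Stieltjes sums be expanded over the same pairs of intervals.\<close>

lemma cut_diff_commute: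
  assumes "u \<le> v" "u' \<le> v'"
  shows "cut_diff g {u..v} {u'..v'} = cut_diff g {u'..v'} {u..v}"
proof -
  consider "v < u'" | "v' < u" | "u' \<le> v" "u \<le> v'" by linarith
  then show ?thesis
    by cases (use assms in \<open>auto simp: cut_diff_def max_def min_def\<close>)
qed

lemma sum_cut_diff:
  assumes p: "p tagged_division_of {a..b}" and "a \<le> u" "u \<le> v" "v \<le> b"
  shows "(\<Sum>(y, m)\<in>p. cut_diff g {u..v} m) = g v - g u"
  unfolding cut_diff_def
  by (subst additive_tagged_division_1[OF _ p]) (use assms in auto)

text \<open>On the common refinement both sums carry the same increments of g, so only the
  oscillation of f across overlapping intervals remains; the increments are dominated by those of
  \<open>\<rho>\<close>, which telescope.\<close>

lemma stieltjes_sum_close: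
  fixes g :: "real \<Rightarrow> complex" and \<rho> :: "real \<Rightarrow> real"
  assumes p: "p tagged_division_of {a..b}" and q: "q tagged_division_of {a..b}"
    and ab: "a \<le> b"
    and g: "\<And>s t. a \<le> s \<Longrightarrow> s \<le> t \<Longrightarrow> t \<le> b \<Longrightarrow> cmod (g t - g s) \<le> \<rho> t - \<rho> s"
    and f: "\<And>x k y m. (x, k) \<in> p \<Longrightarrow> (y, m) \<in> q \<Longrightarrow> k \<inter> m \<noteq> {} \<Longrightarrow> norm (f x - f y) \<le> e"
  shows "norm (stieltjes_sum g f p - stieltjes_sum g f q) \<le> (\<rho> b - \<rho> a) * e"
proof -
  have fin: "finite p" "finite q" using p q by auto
  have cut: "(\<Sum>(y, m)\<in>p'. cut_diff h k m) = h (Sup k) - h (Inf k)"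
    if p': "p' tagged_division_of {a..b}" and q': "q' tagged_division_of {a..b}" and k: "(x, k) \<in> q'"
    for p' q' x k and h :: "real \<Rightarrow> 'z::real_normed_vector"
    by (rule tagged_division_of_real_interval[OF q' k]) (simp add: sum_cut_diff[OF p'])
  have "stieltjes_sum g f p = (\<Sum>(x, k)\<in>p. \<Sum>(y, m)\<in>q. cut_diff g k m *\<^sub>C f x)"
    by (rule sum.cong) (auto simp: cut[OF q p, symmetric] scaleC.sum_left split_beta)
  moreover have "stieltjes_sum g f q = (\<Sum>(x, k)\<in>p. \<Sum>(y, m)\<in>q. cut_diff g k m *\<^sub>C f y)"
  proof -
    have "stieltjes_sum g f q = (\<Sum>(y, m)\<in>q. \<Sum>(x, k)\<in>p. cut_diff g m k *\<^sub>C f y)"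
      by (rule sum.cong) (auto simp: cut[OF p q, symmetric] scaleC.sum_left split_beta)
    also have "\<dots> = (\<Sum>(y, m)\<in>q. \<Sum>(x, k)\<in>p. cut_diff g k m *\<^sub>C f y)"
    proof (intro sum.cong refl, clarsimp, intro sum.cong refl, clarsimp)
      fix y m x k assume "(y, m) \<in> q" "(x, k) \<in> p"
      from tagged_division_of_real_interval[OF q this(1)] obtain u v
        where "m = {u..v}" "u \<le> y" "y \<le> v" .
      moreover from tagged_division_of_real_interval[OF p \<open>(x, k) \<in> p\<close>] obtain u' v'
        where "k = {u'..v'}" "u' \<le> x" "x \<le> v'" .
      ultimately show "cut_diff g m k *\<^sub>C f y = cut_diff g k m *\<^sub>C f y"
        by (simp add: cut_diff_commute)
    qed
    also have "\<dots> = (\<Sum>(x, k)\<in>p. \<Sum>(y, m)\<in>q. cut_diff g k m *\<^sub>C f y)"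
      unfolding split_beta by (rule sum.swap)
    finally show ?thesis .
  qed
  ultimately have "stieltjes_sum g f p - stieltjes_sum g f q
     = (\<Sum>(x, k)\<in>p. \<Sum>(y, m)\<in>q. cut_diff g k m *\<^sub>C (f x - f y))"
    by (simp add: sum_subtractf split_beta scaleC_diff_right)
  also have "norm \<dots> \<le> (\<Sum>(x, k)\<in>p. \<Sum>(y, m)\<in>q. cut_diff \<rho> k m * e)"
    unfolding split_beta
  proof (intro sum_norm_le)
    fix z w assume zw: "z \<in> p" "w \<in> q"
    obtain x k y m where eq: "z = (x, k)" "w = (y, m)" by (metis surj_pair)
    obtain u v where k: "k = {u..v}" "a \<le> u" "u \<le> x" "x \<le> v" "v \<le> b"
      using tagged_division_of_real_interval[OF p] zw eq by metis
    obtain u' v' where m: "m = {u'..v'}" "a \<le> u'" "u' \<le> y" "y \<le> v'" "v' \<le> b"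
      using tagged_division_of_real_interval[OF q] zw eq by metis
    have le: "cmod (cut_diff g k m) \<le> cut_diff \<rho> k m"
      unfolding cut_diff_def by (rule g) (use k m in auto)
    have "norm (cut_diff g k m *\<^sub>C (f x - f y)) \<le> cut_diff \<rho> k m * e"
    proof (cases "k \<inter> m = {}")
      case True
      then have "v < u' \<or> v' < u" using k m by auto
      then have "cut_diff g k m = 0" "cut_diff \<rho> k m = 0" using k m by (auto simp: cut_diff_def max_def min_def)
      then show ?thesis by (simp add: scaleC.zero_left)
    next
      case False
      then show ?thesis unfolding norm_scaleC
        using f[of x k y m] le zw eq order_trans[OF norm_ge_zero le] by (intro mult_mono) auto
    qed
    then show "norm (cut_diff g (snd z) (snd w) *\<^sub>C (f (fst z) - f (fst w))) \<le> cut_diff \<rho> (snd z) (snd w) * e"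
      by (simp add: eq)
  qed
  also have "\<dots> = (\<Sum>(x, k)\<in>p. (\<rho> (Sup k) - \<rho> (Inf k)) * e)"
    by (rule sum.cong) (auto simp: cut[OF q p, symmetric] sum_distrib_right split_beta)
  also have "\<dots> = (\<rho> b - \<rho> a) * e"
    using additive_tagged_division_1[OF ab p, of \<rho>] by (simp add: split_beta flip: sum_distrib_right)
  finally show ?thesis .
qed

lemma has_stieltjes_integral_continuous:
  fixes g :: "real \<Rightarrow> complex" and F :: "complex \<Rightarrow> 'b::{complex_normed_vector,banach}"
  assumes ab: "a \<le> b"
    and g: "\<And>s t. a \<le> s \<Longrightarrow> s \<le> t \<Longrightarrow> t \<le> b \<Longrightarrow> cmod (g t - g s) \<le> \<rho> t - \<rho> s"
    and F: "continuous_on {a..b} (\<lambda>t. F (g t))"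
  shows "\<exists>I. has_stieltjes_integral g F I a b"
  unfolding has_stieltjes_integral_def
proof (rule cauchy_filter_tendsto[OF division_filter_real_neq_bot])
  fix e :: real assume e: "e > 0"
  \<comment> \<open>The summand 1 covers the case \<open>\<rho> b = \<rho> a\<close>.\<close>
  define e' where "e' = e / (\<rho> b - \<rho> a + 1)"
  have \<rho>: "\<rho> b - \<rho> a \<ge> 0" using g[of a b] ab norm_ge_zero[of "g b - g a"] by linarith
  then have e': "e' > 0" "(\<rho> b - \<rho> a) * e' < e" using e by (auto simp: e'_def field_simps)
  from compact_uniformly_continuous[OF F compact_Icc] obtain d
    where d: "d > 0" "\<And>x y. x \<in> {a..b} \<Longrightarrow> y \<in> {a..b} \<Longrightarrow> dist x y < d \<Longrightarrow> dist (F (g x)) (F (g y)) < e'"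
    using e' unfolding uniformly_continuous_on_def by (metis dist_commute)
  \<comment> \<open>Radius \<open>d / 2\<close> puts the tags of overlapping intervals at distance
    less than d.\<close>
  define P where "P p \<longleftrightarrow> p tagged_division_of {a..b} \<and> (\<lambda>x. ball x (d / 2)) fine p" for p :: "(real \<times> real set) set"
  have "eventually P (division_filter {a..b})"
    unfolding eventually_division_filter P_def using d(1) by (intro exI[of _ "\<lambda>x. ball x (d / 2)"]) auto
  moreover have "dist (stieltjes_sum g (\<lambda>t. F (g t)) p) (stieltjes_sum g (\<lambda>t. F (g t)) q) < e" if PP: "P p" "P q" for p q
  proof -
    have "norm (stieltjes_sum g (\<lambda>t. F (g t)) p - stieltjes_sum g (\<lambda>t. F (g t)) q) \<le> (\<rho> b - \<rho> a) * e'"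
    proof (rule stieltjes_sum_close[where a = a and b = b and \<rho> = \<rho>])
      fix x k y m assume xy: "(x, k) \<in> p" "(y, m) \<in> q" "k \<inter> m \<noteq> {}"
      then obtain z where "z \<in> k" "z \<in> m" by blast
      moreover have "k \<subseteq> ball x (d/2)" "m \<subseteq> ball y (d/2)"
        using PP xy(1,2) unfolding P_def fine_def by auto
      ultimately have "dist x z < d/2" "dist y z < d/2" by auto
      then have "dist x y < d" using dist_triangle2[of x y z] by linarith
      moreover have "x \<in> {a..b}" "y \<in> {a..b}"
        using tag_in_interval[of p "{a..b}" x k] tag_in_interval[of q "{a..b}" y m] PP xy(1,2)
        unfolding P_def by auto
      ultimately show "norm (F (g x) - F (g y)) \<le> e'"
        using d(2)[of x y] by (simp add: dist_norm)
    qed (use PP ab g in \<open>auto simp: P_def\<close>)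
    then show ?thesis using e'(2) by (simp add: dist_norm)
  qed
  ultimately show "\<exists>P. eventually P (division_filter {a..b}) \<and> (\<forall>p q. P p \<and> P q \<longrightarrow>
     dist (stieltjes_sum g (\<lambda>t. F (g t)) p) (stieltjes_sum g (\<lambda>t. F (g t)) q) < e)"
    by blast
qed

text \<open>In the application \<open>\<Psi>\<close> is an indefinite integral of \<open>\<psi>\<close> with respect to \<open>\<rho>\<close>.\<close>

lemma has_stieltjes_integral_bound:
  fixes g :: "real \<Rightarrow> complex" and F :: "complex \<Rightarrow> 'b::complex_normed_vector"
  assumes ab: "a \<le> b" and M: "M \<ge> 0"
    and g: "\<And>s t. a \<le> s \<Longrightarrow> s \<le> t \<Longrightarrow> t \<le> b \<Longrightarrow> cmod (g t - g s) \<le> \<rho> t - \<rho> s"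
    and I: "has_stieltjes_integral g F I a b"
    and F: "\<And>t. a \<le> t \<Longrightarrow> t \<le> b \<Longrightarrow> norm (F (g t)) \<le> M * \<psi> t"
    and \<psi>: "continuous_on {a..b} \<psi>" "\<And>t. a \<le> t \<Longrightarrow> t \<le> b \<Longrightarrow> \<psi> t \<ge> 0"
    and \<Psi>: "\<And>s t m. a \<le> s \<Longrightarrow> s \<le> t \<Longrightarrow> t \<le> b \<Longrightarrow> (\<And>r. s \<le> r \<Longrightarrow> r \<le> t \<Longrightarrow> m \<le> \<psi> r) \<Longrightarrow>
           m * (\<rho> t - \<rho> s) \<le> \<Psi> t - \<Psi> s"
  shows "norm I \<le> M * (\<Psi> b - \<Psi> a)"
proof -
  let ?S = "stieltjes_sum g (\<lambda>t. F (g t))"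
  have \<rho>: "\<rho> b - \<rho> a \<ge> 0" using g[of a b] ab norm_ge_zero[of "g b - g a"] by linarith
  have approx: "norm I \<le> M * (\<Psi> b - \<Psi> a + e * (\<rho> b - \<rho> a))" if e: "e > 0" for e
  proof (rule tendsto_upperbound)
    show "((\<lambda>p. norm (?S p)) \<longlongrightarrow> norm I) (division_filter {a..b})"
      by (intro tendsto_norm I[unfolded has_stieltjes_integral_def])
    from compact_uniformly_continuous[OF \<psi>(1) compact_Icc] obtain d
      where d: "d > 0" "\<And>x y. x \<in> {a..b} \<Longrightarrow> y \<in> {a..b} \<Longrightarrow> dist x y < d \<Longrightarrow> dist (\<psi> x) (\<psi> y) < e"
      using e unfolding uniformly_continuous_on_def by (metis dist_commute)
    have "norm (?S p) \<le> M * (\<Psi> b - \<Psi> a + e * (\<rho> b - \<rho> a))"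
      if p: "p tagged_division_of {a..b}" and fine: "(\<lambda>x. ball x d) fine p" for p
    proof -
      let ?h = "\<lambda>t. M * (\<Psi> t + e * \<rho> t)"
      have "norm (?S p) \<le> (\<Sum>(x, k)\<in>p. ?h (Sup k) - ?h (Inf k))"
        unfolding split_beta
      proof (rule sum_norm_le)
        fix z assume "z \<in> p"
        then obtain x k where z: "z = (x, k)" "(x, k) \<in> p" by (metis surj_pair)
        obtain u v where k: "k = {u..v}" "a \<le> u" "u \<le> x" "x \<le> v" "v \<le> b"
          using tagged_division_of_real_interval[OF p z(2)] .
        have "{u..v} \<subseteq> ball x d" using fineD[OF fine z(2)] k by simp
        \<comment> \<open>\<open>\<psi> x - e\<close> is a lower bound of \<open>\<psi>\<close> on
          the interval and plays the role of m in the hypothesis on \<open>\<Psi>\<close>; it may be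
          negative.\<close>
        then have "\<psi> x - e \<le> \<psi> r" if "u \<le> r" "r \<le> v" for r
          using d(2)[of x r] that k by (fastforce simp: dist_real_def)
        then have 1: "(\<psi> x - e) * (\<rho> v - \<rho> u) \<le> \<Psi> v - \<Psi> u"
          using k by (intro \<Psi>) auto
        have "cmod (g v - g u) \<le> \<rho> v - \<rho> u" "norm (F (g x)) \<le> M * \<psi> x"
          using g[of u v] F[of x] k by auto
        then have "norm ((g v - g u) *\<^sub>C F (g x)) \<le> (\<rho> v - \<rho> u) * (M * \<psi> x)"
          unfolding norm_scaleC by (rule mult_mono) (use order_trans[OF norm_ge_zero g[of u v]] k in auto)
        also have "\<dots> = M * ((\<psi> x - e) * (\<rho> v - \<rho> u) + e * (\<rho> v - \<rho> u))"
          by (simp add: algebra_simps)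
        also have "\<dots> \<le> M * (\<Psi> v - \<Psi> u + e * (\<rho> v - \<rho> u))"
          using 1 M by (intro mult_left_mono add_right_mono) auto
        also have "\<dots> = ?h v - ?h u" by (simp add: algebra_simps)
        finally show "norm ((g (Sup (snd z)) - g (Inf (snd z))) *\<^sub>C F (g (fst z))) \<le> ?h (Sup (snd z)) - ?h (Inf (snd z))"
          using z k by simp
      qed
      also have "\<dots> = ?h b - ?h a" by (rule additive_tagged_division_1[OF ab p])
      finally show ?thesis by (simp add: algebra_simps)
    qed
    then show "\<forall>\<^sub>F p in division_filter {a..b}. norm (?S p) \<le> M * (\<Psi> b - \<Psi> a + e * (\<rho> b - \<rho> a))"
      unfolding eventually_division_filter using d(1) by (intro exI[of _ "\<lambda>x. ball x d"]) auto
  qed (rule division_filter_real_neq_bot)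
  show ?thesis
  proof (rule field_le_epsilon)
    fix e :: real assume e: "e > 0"
    \<comment> \<open>The tolerance is scaled so that the error term is at most e; the summand 1
      avoids division by 0.\<close>
    have "M * (\<rho> b - \<rho> a) \<ge> 0" using M \<rho> by simp
    then have "e / (M * (\<rho> b - \<rho> a) + 1) * (M * (\<rho> b - \<rho> a)) \<le> e"
      using e by (simp add: field_simps)
    moreover have "e / (M * (\<rho> b - \<rho> a) + 1) > 0" using e \<open>M * (\<rho> b - \<rho> a) \<ge> 0\<close> by simp
    ultimately show "norm I \<le> M * (\<Psi> b - \<Psi> a) + e"
      using approx[of "e / (M * (\<rho> b - \<rho> a) + 1)"] by (simp add: algebra_simps)
  qed
qed

section \<open>Integration over the arc and the ray\<close>

text \<open>Choose s where \<open>\<Psi>\<close> nearly attains its supremum: beyond s it can grow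
  only little, so P can move only little. R is the direction of approach, so that one statement
  covers both ends of the arc and the ray.\<close>

lemma tendsto_of_bounded_increments:
  fixes P :: "'a \<Rightarrow> 'b::complete_space" and \<Psi> :: "'a \<Rightarrow> real"
  assumes "F \<noteq> bot" "A \<noteq> {}" and M: "M \<ge> 0"
    and ev: "\<And>s. s \<in> A \<Longrightarrow> \<forall>\<^sub>F t in F. t \<in> A \<and> R s t"
    and W: "\<And>t. t \<in> A \<Longrightarrow> \<Psi> t \<le> W"
    and P: "\<And>s t. s \<in> A \<Longrightarrow> t \<in> A \<Longrightarrow> R s t \<Longrightarrow> dist (P s) (P t) \<le> M * (\<Psi> t - \<Psi> s)"
  shows "\<exists>l. (P \<longlongrightarrow> l) F"
proof (rule cauchy_filter_tendsto[OF \<open>F \<noteq> bot\<close>])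
  fix e :: real assume e: "e > 0"
  define e' where "e' = e / (2 * (M + 1))"
  have e': "e' > 0" "M * e' < e / 2" using e M by (auto simp: e'_def field_simps)
  have bdd: "bdd_above (\<Psi> ` A)" using W by (auto intro!: bdd_aboveI2)
  have "\<exists>x\<in>\<Psi> ` A. Sup (\<Psi> ` A) - e' < x"
    by (rule less_cSupD) (use assms e' in auto)
  then obtain s where s: "s \<in> A" "\<Psi> s > Sup (\<Psi> ` A) - e'" by auto
  have near: "dist (P s) (P t) < e / 2" if "t \<in> A" "R s t" for t
  proof -
    have "\<Psi> t \<le> Sup (\<Psi> ` A)" using that by (intro cSup_upper bdd) auto
    then have "M * (\<Psi> t - \<Psi> s) \<le> M * e'" using M s by (intro mult_left_mono) auto
    then show ?thesis using P[OF s(1) that] e' by linarith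
  qed
  have "dist (P x) (P y) < e" if "x \<in> A \<and> R s x" "y \<in> A \<and> R s y" for x y
    using near[of x] near[of y] dist_triangle3[of "P x" "P y" "P s"] that by linarith
  then show "\<exists>Q. eventually Q F \<and> (\<forall>x y. Q x \<and> Q y \<longrightarrow> dist (P x) (P y) < e)"
    using ev[OF s(1)] by blast
qed

lemma eventually_arc_filter:
  assumes "0 < c" "c < 1"
  shows "\<forall>\<^sub>F p in at_right 0 \<times>\<^sub>F at_left 1. 0 < fst p \<and> fst p < c \<and> c < snd p \<and> snd p < (1::real)"
proof -
  have "\<forall>\<^sub>F a in at_right 0. 0 < a \<and> a < c"
    using eventually_at_right_real[OF assms(1)] by eventually_elim simp
  moreover have "\<forall>\<^sub>F b in at_left 1. c < b \<and> b < (1::real)"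
    using eventually_at_left_real[OF assms(2)] by eventually_elim simp
  ultimately show ?thesis
    by (rule eventually_mono[OF eventually_prodI]) auto
qed

lemma arc_filter_neq_bot: "at_right 0 \<times>\<^sub>F at_left 1 \<noteq> (bot :: (real \<times> real) filter)"
  by (simp add: prod_filter_eq_bot)

lemma has_arc_integral_diff:
  assumes "has_arc_integral g F I" "has_arc_integral g G J"
  shows "has_arc_integral g (\<lambda>\<mu>. F \<mu> - G \<mu>) (I - J)"
proof -
  from assms(1) obtain F' where F': "(F' \<longlongrightarrow> I) (at_right 0 \<times>\<^sub>F at_left 1)"
    "\<And>a b. 0 < a \<Longrightarrow> a \<le> b \<Longrightarrow> b < 1 \<Longrightarrow> has_stieltjes_integral g F (F' (a, b)) a b"
    unfolding has_arc_integral_def by auto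
  from assms(2) obtain G' where G': "(G' \<longlongrightarrow> J) (at_right 0 \<times>\<^sub>F at_left 1)"
    "\<And>a b. 0 < a \<Longrightarrow> a \<le> b \<Longrightarrow> b < 1 \<Longrightarrow> has_stieltjes_integral g G (G' (a, b)) a b"
    unfolding has_arc_integral_def by auto
  show ?thesis unfolding has_arc_integral_def
    by (rule exI[of _ "\<lambda>p. F' p - G' p"])
      (auto intro!: tendsto_diff F'(1) G'(1) has_stieltjes_integral_diff F'(2) G'(2))
qed

context
  fixes g :: "real \<Rightarrow> complex" and F :: "complex \<Rightarrow> 'b::{complex_normed_vector,banach}"
    and \<rho> \<psi> \<Psi> :: "real \<Rightarrow> real" and M W :: real
  assumes g: "\<And>s t. 0 < s \<Longrightarrow> s \<le> t \<Longrightarrow> t < 1 \<Longrightarrow> cmod (g t - g s) \<le> \<rho> t - \<rho> s"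
    and M: "M \<ge> 0"
    and \<psi>: "continuous_on {0<..<1} \<psi>" "\<And>t. 0 < t \<Longrightarrow> t < 1 \<Longrightarrow> \<psi> t \<ge> 0"
    and \<Psi>: "\<And>s t m. 0 < s \<Longrightarrow> s \<le> t \<Longrightarrow> t < 1 \<Longrightarrow> (\<And>r. s \<le> r \<Longrightarrow> r \<le> t \<Longrightarrow> m \<le> \<psi> r) \<Longrightarrow>
           m * (\<rho> t - \<rho> s) \<le> \<Psi> t - \<Psi> s"
    and W: "\<And>t. 0 < t \<Longrightarrow> t < 1 \<Longrightarrow> 0 \<le> \<Psi> t \<and> \<Psi> t \<le> W"
    and F: "\<And>t. 0 < t \<Longrightarrow> t < 1 \<Longrightarrow> norm (F (g t)) \<le> M * \<psi> t"
begin

lemma stieltjes_integral_subarc_bound: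
  assumes "0 < a" "a \<le> b" "b < 1" "has_stieltjes_integral g F I a b"
  shows "norm I \<le> M * (\<Psi> b - \<Psi> a)"
proof (rule has_stieltjes_integral_bound[OF assms(2) M _ assms(4)])
  show "cmod (g t - g s) \<le> \<rho> t - \<rho> s" if "a \<le> s" "s \<le> t" "t \<le> b" for s t
    using that assms by (intro g) auto
  show "norm (F (g t)) \<le> M * \<psi> t" "\<psi> t \<ge> 0" if "a \<le> t" "t \<le> b" for t
    using F \<psi>(2) that assms by auto
  show "continuous_on {a..b} \<psi>" by (rule continuous_on_subset[OF \<psi>(1)]) (use assms in auto)
  show "m * (\<rho> t - \<rho> s) \<le> \<Psi> t - \<Psi> s"
    if "a \<le> s" "s \<le> t" "t \<le> b" "\<And>r. s \<le> r \<Longrightarrow> r \<le> t \<Longrightarrow> m \<le> \<psi> r" for s t m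
    using that assms by (intro \<Psi>) auto
qed

lemma has_arc_integral_bound:
  assumes "has_arc_integral g F I"
  shows "norm I \<le> M * W"
proof -
  from assms obtain J where J: "(J \<longlongrightarrow> I) (at_right 0 \<times>\<^sub>F at_left 1)"
    "\<And>a b. 0 < a \<Longrightarrow> a \<le> b \<Longrightarrow> b < 1 \<Longrightarrow> has_stieltjes_integral g F (J (a, b)) a b"
    unfolding has_arc_integral_def by auto
  \<comment> \<open>The point 1/2 only ensures that the two end points are in the right
    order.\<close>
  have "norm (J p) \<le> M * W" if "0 < fst p \<and> fst p < 1/2 \<and> 1/2 < snd p \<and> snd p < 1" for p
  proof -
    have "norm (J p) \<le> M * (\<Psi> (snd p) - \<Psi> (fst p))"
      by (rule stieltjes_integral_subarc_bound[OF _ _ _ J(2), of "fst p" "snd p", simplified]) (use that in auto)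
    also have "\<dots> \<le> M * W"
      using W[of "fst p"] W[of "snd p"] that by (intro mult_left_mono[OF _ M]) auto
    finally show ?thesis .
  qed
  then have "\<forall>\<^sub>F p in at_right 0 \<times>\<^sub>F at_left 1. norm (J p) \<le> M * W"
    using eventually_arc_filter[of "1/2"] by (auto elim: eventually_mono)
  then show ?thesis by (rule tendsto_upperbound[OF tendsto_norm[OF J(1)] _ arc_filter_neq_bot])
qed

text \<open>A primitive P based at 1/2 splits the limit in two variables into one limit at each end,
  where the bounded function \<open>\<Psi>\<close> controls the increments.\<close>

lemma has_arc_integral_exists:
  assumes cont: "continuous_on {0<..<1} (\<lambda>t. F (g t))"
  shows "\<exists>I. has_arc_integral g F I"
proof -
  have "\<exists>I. has_stieltjes_integral g F I a b" if "0 < a" "a \<le> b" "b < 1" for a b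
  proof (rule has_stieltjes_integral_continuous[OF that(2)])
    show "cmod (g t - g s) \<le> \<rho> t - \<rho> s" if "a \<le> s" "s \<le> t" "t \<le> b" for s t
      using that \<open>0 < a\<close> \<open>b < 1\<close> by (intro g) auto
    show "continuous_on {a..b} (\<lambda>t. F (g t))"
      by (rule continuous_on_subset[OF cont]) (use that in auto)
  qed
  then obtain J where J: "\<And>a b. 0 < a \<Longrightarrow> a \<le> b \<Longrightarrow> b < 1 \<Longrightarrow> has_stieltjes_integral g F (J a b) a b"
    by metis
  define P where "P t = (if t \<ge> 1/2 then J (1/2) t else - J t (1/2))" for t
  have combine: "J a c = J a b + J b c" if "0 < a" "a \<le> b" "b \<le> c" "c < 1" for a b c
    by (rule has_stieltjes_integral_combine[OF that(2,3) J J J]) (use that in auto)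
  have J_eq: "J a b = P b - P a" if "0 < a" "a \<le> b" "b < 1" for a b
    using combine[of a b "1/2"] combine[of a "1/2" b] combine[of "1/2" a b] that by (auto simp: P_def)
  have P_dist: "dist (P s) (P t) \<le> M * (\<Psi> t - \<Psi> s)" if "0 < s" "s \<le> t" "t < 1" for s t
    using stieltjes_integral_subarc_bound[OF that J[OF that]] J_eq[OF that] by (simp add: dist_norm norm_minus_commute)
  have "\<exists>l. (P \<longlongrightarrow> l) (at_left 1)"
  proof (rule tendsto_of_bounded_increments[where A = "{0<..<1}" and R = "(\<le>)" and \<Psi> = \<Psi> and W = W, OF _ _ M])
    fix s :: real assume s: "s \<in> {0<..<1}"
    have "\<forall>\<^sub>F t in at_left 1. t \<in> {s<..<1}" by (rule eventually_at_left_real) (use s in simp)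
    then show "\<forall>\<^sub>F t in at_left 1. t \<in> {0<..<1} \<and> s \<le> t" by eventually_elim (use s in auto)
  qed (use W P_dist in auto)
  then obtain r where r: "(P \<longlongrightarrow> r) (at_left 1)" ..
  \<comment> \<open>Toward 0 the order is reversed, so \<open>- \<Psi>\<close> takes the place of
    \<open>\<Psi>\<close>, with upper bound 0.\<close>
  have "\<exists>l. (P \<longlongrightarrow> l) (at_right 0)"
  proof (rule tendsto_of_bounded_increments[where A = "{0<..<1}" and R = "(\<ge>)" and \<Psi> = "\<lambda>t. - \<Psi> t" and W = 0, OF _ _ M])
    fix s :: real assume s: "s \<in> {0<..<1}"
    have "\<forall>\<^sub>F t in at_right 0. t \<in> {0<..<s}" by (rule eventually_at_right_real) (use s in simp)
    then show "\<forall>\<^sub>F t in at_right 0. t \<in> {0<..<1} \<and> t \<le> s" by eventually_elim (use s in auto)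
    show "dist (P s) (P t) \<le> M * (- \<Psi> t - - \<Psi> s)" if "s \<in> {0<..<1}" "t \<in> {0<..<1}" "t \<le> s" for s t
      using P_dist[of t s] that by (simp add: dist_commute)
  qed (use W in auto)
  then obtain l where l: "(P \<longlongrightarrow> l) (at_right 0)" ..
  have "((\<lambda>p. P (snd p) - P (fst p)) \<longlongrightarrow> r - l) (at_right 0 \<times>\<^sub>F at_left 1)"
    by (intro tendsto_diff filterlim_compose[OF r filterlim_snd] filterlim_compose[OF l filterlim_fst])
  then have "((\<lambda>p. J (fst p) (snd p)) \<longlongrightarrow> r - l) (at_right 0 \<times>\<^sub>F at_left 1)"
  proof (rule Lim_transform_eventually)
    show "\<forall>\<^sub>F p in at_right 0 \<times>\<^sub>F at_left 1. P (snd p) - P (fst p) = J (fst p) (snd p)"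
      using eventually_arc_filter[of "1/2"] by (auto elim!: eventually_mono simp: J_eq)
  qed
  then show ?thesis unfolding has_arc_integral_def using J
    by (intro exI[of _ "r - l"] exI[of _ "\<lambda>p. J (fst p) (snd p)"]) auto
qed

end

text \<open>\<open>\<Psi> t\<close> is the integral of \<open>\<psi>\<close> over the half-open
  interval \<open>(0, t]\<close>. For monotone, right-continuous \<open>\<rho>\<close> the interval
  \<open>(s, t]\<close> has mass \<open>\<rho> t - \<rho> s\<close>, so a lower bound of
  \<open>\<psi>\<close> there passes to the increment of \<open>\<Psi>\<close>.\<close>

lemma ex_indefinite_stieltjes_integral:
  fixes \<rho> \<psi> :: "real \<Rightarrow> real"
  assumes mono: "\<And>s t. s \<le> t \<Longrightarrow> \<rho> s \<le> \<rho> t" and cont: "\<And>t. continuous (at_right t) \<rho>"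
    and \<psi>: "continuous_on {0<..<1} \<psi>"
    and fin: "(\<integral>\<^sup>+t\<in>{0<..<1}. ennreal (\<psi> t) \<partial>interval_measure \<rho>) < \<infinity>"
  obtains \<Psi> where
    "\<And>s t m. 0 < s \<Longrightarrow> s \<le> t \<Longrightarrow> t < 1 \<Longrightarrow> (\<And>r. s \<le> r \<Longrightarrow> r \<le> t \<Longrightarrow> m \<le> \<psi> r) \<Longrightarrow>
       m * (\<rho> t - \<rho> s) \<le> \<Psi> t - \<Psi> s"
    "\<And>t. 0 < t \<Longrightarrow> t < 1 \<Longrightarrow>
       0 \<le> \<Psi> t \<and> \<Psi> t \<le> enn2real (\<integral>\<^sup>+t\<in>{0<..<1}. ennreal (\<psi> t) \<partial>interval_measure \<rho>)"
proof -
  let ?\<mu> = "interval_measure \<rho>"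
  \<comment> \<open>Extension by 0 gives a Borel function on the whole line, although
    \<open>\<psi>\<close> is only known to be continuous on the open interval.\<close>
  define f where "f t = (if t \<in> {0<..<1} then ennreal (\<psi> t) else 0)" for t
  have "f \<in> borel_measurable borel"
    unfolding f_def using \<psi>
    by (intro borel_measurable_continuous_on_if) (auto intro!: continuous_on_ennreal)
  then have f[measurable]: "f \<in> borel_measurable ?\<mu>" by simp
  define N where "N A = (\<integral>\<^sup>+t\<in>A. f t \<partial>?\<mu>)" for A
  have total: "(\<integral>\<^sup>+t\<in>{0<..<1}. ennreal (\<psi> t) \<partial>?\<mu>) = N {0<..<1}"
    unfolding N_def by (rule nn_integral_cong) (simp add: f_def split: split_indicator)
  have le: "N {0<..t} \<le> N {0<..<1}" if "t < 1" for t
    unfolding N_def by (rule nn_integral_mono) (use that in \<open>auto split: split_indicator\<close>)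
  have finN: "N {0<..t} < \<infinity>" if "t < 1" for t
    using le[OF that] fin total by (simp add: le_less_trans)
  show thesis
  proof (rule that[of "\<lambda>t. enn2real (N {0<..t})"])
    fix s t m :: real
    assume st: "0 < s" "s \<le> t" "t < 1" and m: "\<And>r. s \<le> r \<Longrightarrow> r \<le> t \<Longrightarrow> m \<le> \<psi> r"
    have split: "N {0<..t} = N {0<..s} + N {s<..t}"
    proof -
      have "{0<..t} = {0<..s} \<union> {s<..t}" using st by auto
      then show ?thesis unfolding N_def by (simp only:) (rule nn_integral_disjoint_pair, auto)
    qed
    have "N {s<..t} \<le> N {0<..t}" unfolding split by simp
    then have "N {s<..t} < \<infinity>" using finN[OF st(3)] by (rule le_less_trans)
    then have diff: "enn2real (N {0<..t}) - enn2real (N {0<..s}) = enn2real (N {s<..t})"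
      using finN[of s] st unfolding split by (simp add: enn2real_plus)
    show "m * (\<rho> t - \<rho> s) \<le> enn2real (N {0<..t}) - enn2real (N {0<..s})"
    proof (cases "m \<ge> 0")
      case True
      have "ennreal (m * (\<rho> t - \<rho> s)) = ennreal m * emeasure ?\<mu> {s<..t}"
        using True mono[OF st(2)] st by (simp add: emeasure_interval_measure_Ioc mono cont ennreal_mult)
      also have "\<dots> = (\<integral>\<^sup>+r\<in>{s<..t}. ennreal m \<partial>?\<mu>)" by (simp add: nn_integral_cmult_indicator)
      also have "\<dots> \<le> N {s<..t}" unfolding N_def
        by (rule nn_integral_mono) (use st m in \<open>auto split: split_indicator simp: f_def intro!: ennreal_leI\<close>)
      finally have "enn2real (ennreal (m * (\<rho> t - \<rho> s))) \<le> enn2real (N {s<..t})"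
        using \<open>N {s<..t} < \<infinity>\<close> by (intro enn2real_mono) auto
      then show ?thesis using True mono[OF st(2)] diff by simp
    next
      case False
      \<comment> \<open>Negative m does occur, as \<open>\<psi> x - e\<close>; then the left-hand
        side is nonpositive and the increment of \<open>\<Psi>\<close> is nonnegative.\<close>
      then have "m * (\<rho> t - \<rho> s) \<le> 0" using mono[OF st(2)] by (simp add: mult_nonpos_nonneg)
      then show ?thesis unfolding diff using enn2real_nonneg order_trans by blast
    qed
  next
    fix t :: real assume "0 < t" "t < 1"
    then show "0 \<le> enn2real (N {0<..t}) \<and> enn2real (N {0<..t})
        \<le> enn2real (\<integral>\<^sup>+t\<in>{0<..<1}. ennreal (\<psi> t) \<partial>?\<mu>)"
      unfolding total using le fin total by (auto intro!: enn2real_mono)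
  qed
qed

section \<open>Improper integrals over the ray\<close>

lemma has_integral_atLeast_limit:
  fixes F :: "real \<Rightarrow> 'b::banach"
  assumes int: "\<And>b. F integrable_on {\<beta>..b}" and lim: "((\<lambda>b. integral {\<beta>..b} F) \<longlongrightarrow> I) at_top"
  shows "(F has_integral I) {\<beta>..}"
  unfolding has_integral_alt'[of F]
proof (intro conjI allI impI)
  have inter: "{\<beta>..} \<inter> {a..b} = {max \<beta> a..b}" for a b by auto
  show "(\<lambda>x. if x \<in> {\<beta>..} then F x else 0) integrable_on cbox a b" for a b
    unfolding integrable_restrict_Int box_real inter
    by (rule integrable_on_subinterval[OF int[of b]]) auto
  fix e :: real assume "e > 0"
  with lim obtain b0 where b0: "\<And>b. b \<ge> b0 \<Longrightarrow> norm (integral {\<beta>..b} F - I) < e"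
    by (auto simp: tendsto_iff eventually_at_top_linorder dist_norm)
  \<comment> \<open>A box around the ball of radius B contains both \<open>\<beta>\<close> and
    \<open>b0\<close>, so the truncated integral is one over \<open>{\<beta>..b}\<close> with
    \<open>b \<ge> b0\<close>.\<close>
  define B where "B = 1 + \<bar>\<beta>\<bar> + \<bar>b0\<bar>"
  have "norm (integral (cbox a b) (\<lambda>x. if x \<in> {\<beta>..} then F x else 0) - I) < e"
    if "ball 0 B \<subseteq> cbox a b" for a b
  proof -
    have "\<bar>\<beta>\<bar> \<in> ball 0 B" "- \<bar>\<beta>\<bar> \<in> ball 0 B" "\<bar>b0\<bar> \<in> ball 0 B" by (auto simp: B_def)
    then have "\<bar>\<beta>\<bar> \<in> cbox a b" "- \<bar>\<beta>\<bar> \<in> cbox a b" "\<bar>b0\<bar> \<in> cbox a b" using that by blast+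
    then have "max \<beta> a = \<beta>" "b0 \<le> b" by auto
    then show ?thesis using b0 unfolding integral_restrict_Int box_real inter by simp
  qed
  moreover have "B > 0" by (simp add: B_def add_pos_nonneg)
  ultimately show "\<exists>B>0. \<forall>a b. ball 0 B \<subseteq> cbox a b \<longrightarrow>
      norm (integral (cbox a b) (\<lambda>x. if x \<in> {\<beta>..} then F x else 0) - I) < e" by blast
qed

context
  fixes F :: "real \<Rightarrow> 'b::banach" and \<phi> :: "real \<Rightarrow> real" and \<beta> M :: real
  assumes \<phi>: "continuous_on {\<beta>..} \<phi>" "\<And>t. t \<ge> \<beta> \<Longrightarrow> \<phi> t \<ge> 0"
    and fin: "(\<integral>\<^sup>+t\<in>{\<beta>..}. ennreal (\<phi> t) \<partial>lborel) < \<infinity>"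
    and M: "M \<ge> 0" and F: "\<And>t. t \<ge> \<beta> \<Longrightarrow> norm (F t) \<le> M * \<phi> t"
begin

text \<open>Passage from the nonnegative Lebesgue integral in \<open>arclength_integral\<close> to
  the gauge integral in \<open>has_contour_integral_op\<close>.\<close>

lemma ray_majorant_has_integral:
  "(\<phi> has_integral enn2real (\<integral>\<^sup>+t\<in>{\<beta>..}. ennreal (\<phi> t) \<partial>lborel)) {\<beta>..}"
proof -
  let ?f = "\<lambda>t. if t \<in> {\<beta>..} then \<phi> t else 0"
  have "(\<integral>\<^sup>+t. ennreal (?f t) \<partial>lborel) = (\<integral>\<^sup>+t\<in>{\<beta>..}. ennreal (\<phi> t) \<partial>lborel)"
    by (rule nn_integral_cong) (simp split: split_indicator)
  moreover have "?f \<in> borel_measurable borel"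
    by (rule borel_measurable_continuous_on_if) (use \<phi> in auto)
  ultimately have "(?f has_integral enn2real (\<integral>\<^sup>+t\<in>{\<beta>..}. ennreal (\<phi> t) \<partial>lborel)) UNIV"
    using \<phi>(2) fin by (intro nn_integral_has_integral) (auto simp: less_top)
  then show ?thesis by (simp only: has_integral_restrict_UNIV)
qed

lemma ray_integral_bound:
  assumes "(F has_integral I) {\<beta>..}"
  shows "norm I \<le> M * enn2real (\<integral>\<^sup>+t\<in>{\<beta>..}. ennreal (\<phi> t) \<partial>lborel)"
proof -
  note h = has_integral_mult_right[OF ray_majorant_has_integral, of M]
  have "norm (integral {\<beta>..} F) \<le> integral {\<beta>..} (\<lambda>t. M * \<phi> t)"
    by (rule integral_norm_bound_integral) (use assms h F in auto)
  then show ?thesis using integral_unique[OF assms] integral_unique[OF ray_majorant_has_integral] by simp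
qed

lemma ray_integral_exists:
  assumes cont: "continuous_on {\<beta>..} F"
  shows "\<exists>I. (F has_integral I) {\<beta>..}"
proof -
  let ?N = "enn2real (\<integral>\<^sup>+t\<in>{\<beta>..}. ennreal (\<phi> t) \<partial>lborel)"
  have intF: "F integrable_on {s..t}" if "\<beta> \<le> s" for s t
    by (rule integrable_continuous_interval, rule continuous_on_subset[OF cont]) (use that in auto)
  have int\<phi>: "\<phi> integrable_on {s..t}" if "\<beta> \<le> s" for s t
    by (rule integrable_continuous_interval, rule continuous_on_subset[OF \<phi>(1)]) (use that in auto)
  have "\<exists>l. ((\<lambda>b. integral {\<beta>..b} F) \<longlongrightarrow> l) at_top"
  proof (rule tendsto_of_bounded_increments[where A = "{\<beta>..}" and R = "(\<le>)"
        and \<Psi> = "\<lambda>b. integral {\<beta>..b} \<phi>" and W = ?N, OF _ _ M])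
    fix s assume s: "s \<in> {\<beta>..}"
    show "\<forall>\<^sub>F t in at_top. t \<in> {\<beta>..} \<and> s \<le> t"
      using eventually_ge_at_top[of s] by eventually_elim (use s in auto)
    have "integral {\<beta>..s} \<phi> \<le> integral {\<beta>..} \<phi>"
      using ray_majorant_has_integral int\<phi> \<phi>(2) by (intro integral_subset_le) auto
    then show "integral {\<beta>..s} \<phi> \<le> ?N"
      using integral_unique[OF ray_majorant_has_integral] by simp
  next
    fix s t assume st: "s \<in> {\<beta>..}" "t \<in> {\<beta>..}" "s \<le> t"
    have "norm (integral {s..t} F) \<le> integral {s..t} (\<lambda>r. M * \<phi> r)"
      using st F by (intro integral_norm_bound_integral intF integrable_on_mult_right int\<phi>) auto
    moreover
    have "integral {\<beta>..s} F + integral {s..t} F = integral {\<beta>..t} F"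
      "integral {\<beta>..s} \<phi> + integral {s..t} \<phi> = integral {\<beta>..t} \<phi>"
      by (rule Henstock_Kurzweil_Integration.integral_combine[OF _ st(3)], use st intF int\<phi> in simp_all)+
    then have "integral {\<beta>..t} F - integral {\<beta>..s} F = integral {s..t} F"
      "integral {\<beta>..t} \<phi> - integral {\<beta>..s} \<phi> = integral {s..t} \<phi>"
      by (metis add_diff_cancel_left')+
    ultimately show "dist (integral {\<beta>..s} F) (integral {\<beta>..t} F)
        \<le> M * (integral {\<beta>..t} \<phi> - integral {\<beta>..s} \<phi>)"
      by (simp add: dist_norm norm_minus_commute[of "integral {\<beta>..s} F"])
  qed auto
  then show ?thesis using has_integral_atLeast_limit[OF intF] by blast
qed

end

section \<open>Operator-valued holomorphic functions and resolvents\<close>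

text \<open>Turns operator-valued derivatives into scalar ones, to which complex analysis
  applies.\<close>

lemma bounded_linear_cinner_apply: "bounded_linear (\<lambda>T. cinner (T *\<^sub>V x) y)"
proof (rule bounded_linear_intro)
  show "cinner ((S + T) *\<^sub>V x) y = cinner (S *\<^sub>V x) y + cinner (T *\<^sub>V x) y" for S T
    by (simp add: cblinfun.add_left cinner_add_left)
  show "cinner ((r *\<^sub>R T) *\<^sub>V x) y = r *\<^sub>R cinner (T *\<^sub>V x) y" for r T
    by (simp add: cblinfun.scaleR_left cinner_scaleC_left scaleR_conv_of_real flip: scaleC_of_real)
  show "norm (cinner (T *\<^sub>V x) y) \<le> norm T * (norm x * norm y)" for T
    using cinner_Cauchy_Schwarz[of "T *\<^sub>V x" y] mult_right_mono[OF norm_cblinfun_apply[of T x], of "norm y"]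
    by (simp add: mult.assoc)
qed

text \<open>Cauchy's inequality, applied to the matrix elements of \<open>K(\<cdot> + w) - K\<close>, bounds the
  increment of the derivative by the increment of \<open>K\<close>.\<close>

lemma continuous_on_complex_derivative:
  fixes K K' :: "complex \<Rightarrow> ('a::complex_normed_vector \<Rightarrow>\<^sub>C\<^sub>L 'b::complex_hilbert)"
  assumes "open S" and K: "\<And>z. z \<in> S \<Longrightarrow> (K has_derivative (\<lambda>h. h *\<^sub>C K' z)) (at z)"
  shows "continuous_on S K'"
proof (rule continuous_at_imp_continuous_on, rule ballI)
  fix z assume "z \<in> S"
  then obtain r0 where "r0 > 0" "cball z r0 \<subseteq> S" using \<open>open S\<close> open_contains_cball by blast
  \<comment> \<open>Halving the radius leaves room for the translate: u and \<open>u + w\<close>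
    stay in \<open>cball z (2 * r)\<close> for u in \<open>cball z r\<close> and
    \<open>norm w < r\<close>.\<close>
  define r where "r = r0 / 2"
  have r: "r > 0" "cball z (2 * r) \<subseteq> S" using \<open>r0 > 0\<close> \<open>cball z r0 \<subseteq> S\<close> by (auto simp: r_def)
  have contK: "continuous_on S K"
    by (rule continuous_at_imp_continuous_on) (use K has_derivative_continuous in blast)
  have element: "((\<lambda>w. cinner (K w *\<^sub>V x) y) has_field_derivative cinner (K' w *\<^sub>V x) y) (at w)"
    if "w \<in> S" for w x y
    using bounded_linear.has_derivative[OF bounded_linear_cinner_apply K[OF that], of x y]
    by (simp add: has_field_derivative_def cinner_scaleC_left mult_commute_abs)
  have shifted: "((\<lambda>u. cinner (K (u + w) *\<^sub>V x) y) has_field_derivative cinner (K' (u + w) *\<^sub>V x) y) (at u)"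
    if "u + w \<in> S" for u w x y
    using DERIV_shift[THEN iffD1, OF element[OF that]] .
  show "isCont K' z"
    unfolding continuous_at_eps_delta
  proof (intro allI impI)
    fix e :: real assume e: "e > 0"
    have "uniformly_continuous_on (cball z (2 * r)) K"
      by (intro compact_uniformly_continuous continuous_on_subset[OF contK] r compact_cball)
    then obtain d where d: "d > 0"
      "\<And>u v. u \<in> cball z (2*r) \<Longrightarrow> v \<in> cball z (2*r) \<Longrightarrow> dist v u < d \<Longrightarrow> dist (K v) (K u) < e * r / 2"
      unfolding uniformly_continuous_on_def using e r by (metis half_gt_zero mult_pos_pos)
    have "dist (K' z') (K' z) < e" if z': "dist z' z < min d r" for z'
    proof -
      define w where "w = z' - z"
      have w: "norm w < d" "norm w < r" using z' by (auto simp: w_def dist_norm)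
      have in_S: "u \<in> S" "u + w \<in> S" "dist (K (u + w)) (K u) < e * r / 2" if "u \<in> cball z r" for u
      proof -
        have "norm (u - z) \<le> r" using that by (simp add: dist_norm norm_minus_commute)
        then have "norm (u - z) \<le> 2 * r" "norm (u + w - z) \<le> 2 * r"
          using norm_triangle_ineq[of "u - z" w] w r by (auto simp: algebra_simps)
        then have "u \<in> cball z (2*r)" "u + w \<in> cball z (2*r)" by (auto simp: dist_norm norm_minus_commute)
        then show "u \<in> S" "u + w \<in> S" "dist (K (u + w)) (K u) < e * r / 2"
          using r d(2)[of u "u + w"] w by (auto simp: dist_norm)
      qed
      let ?D = "K' z' - K' z"
      have bound: "cmod (cinner (?D *\<^sub>V x) y) \<le> (e / 2) * norm x * norm y" for x y
      proof -
        define f where "f u = cinner (K (u + w) *\<^sub>V x) y - cinner (K u *\<^sub>V x) y" for u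
        have df: "(f has_field_derivative cinner (K' (u + w) *\<^sub>V x) y - cinner (K' u *\<^sub>V x) y) (at u)"
          if "u \<in> cball z r" for u
          unfolding f_def using in_S[OF that] by (intro DERIV_diff element shifted)
        \<comment> \<open>On the circle of radius r, uniform continuity of K bounds f by
          \<open>e * r / 2\<close> times the norms of x and y; dividing by r leaves
          \<open>e / 2\<close>.\<close>
        have "norm ((deriv ^^ 1) f z) \<le> fact 1 * (e * r / 2 * norm x * norm y) / r ^ 1"
        proof (rule Cauchy_inequality)
          show "f holomorphic_on ball z r"
            by (rule holomorphic_onI, rule field_differentiable_at_within)
              (unfold field_differentiable_def, rule exI, rule df, simp)
          show "continuous_on (cball z r) f"
            by (rule continuous_at_imp_continuous_on) (use df DERIV_isCont in blast)
          show "norm (f u) \<le> e * r / 2 * norm x * norm y" if "norm (z - u) = r" for u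
          proof -
            have u: "u \<in> cball z r" using that by (simp add: dist_norm)
            have "f u = cinner ((K (u + w) - K u) *\<^sub>V x) y"
              by (simp add: f_def cblinfun.diff_left cinner_diff_left)
            also have "cmod \<dots> \<le> norm (K (u + w) - K u) * norm x * norm y"
              by (rule order_trans[OF cinner_Cauchy_Schwarz mult_right_mono[OF norm_cblinfun_apply]]) simp
            also have "\<dots> \<le> e * r / 2 * norm x * norm y"
              using in_S(3)[OF u] by (intro mult_right_mono) (auto simp: dist_norm)
            finally show ?thesis .
          qed
        qed (use r in simp)
        moreover have "deriv f z = cinner (?D *\<^sub>V x) y"
          using DERIV_imp_deriv[OF df[of z]] r by (simp add: w_def cblinfun.diff_left cinner_diff_left)
        ultimately show ?thesis using r by simp
      qed
      \<comment> \<open>Taking y to be the image of x under \<open>?D\<close> turns the bound on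
        matrix elements into an operator norm bound.\<close>
      have "norm ?D \<le> e / 2"
      proof (rule norm_cblinfun_bound)
        fix x
        let ?y = "?D *\<^sub>V x"
        have "norm ?y * norm ?y \<le> (e / 2) * norm x * norm ?y"
          using bound[of x ?y] by (simp add: cinner_self norm_mult power2_eq_square)
        then show "norm ?y \<le> (e / 2) * norm x"
          using e by (cases "norm ?y = 0") (auto simp: mult_le_cancel_right)
      qed (use e in simp)
      then show ?thesis using e by (simp add: dist_norm)
    qed
    then show "\<exists>d>0. \<forall>z'. dist z' z < d \<longrightarrow> dist (K' z') (K' z) < e"
      using d(1) r by (intro exI[of _ "min d r"]) auto
  qed
qed

section \<open>Numerical range, resolvents and spectrum\<close>

lemma infdist_numerical_range_le:
  "infdist z (numerical_range T) * (norm x)\<^sup>2 \<le> cmod (cinner ((T - z *\<^sub>C id_cblinfun) *\<^sub>V x) x)"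
proof (cases "x = 0")
  case False
  \<comment> \<open>Rescaling x to a unit vector makes the value q of the quadratic form a point of
    the numerical range.\<close>
  define c where "c = complex_of_real (1 / norm x)"
  have c: "c * cnj c * complex_of_real ((norm x)\<^sup>2) = 1"
    using False by (simp add: c_def power2_eq_square)
  define q where "q = cinner (T *\<^sub>V (c *\<^sub>C x)) (c *\<^sub>C x)"
  have "norm (c *\<^sub>C x) = 1" using False by (simp add: norm_scaleC c_def norm_divide)
  then have "q \<in> numerical_range T"
    unfolding numerical_range_def q_def by (intro closure_subset[THEN subsetD]) blast
  then have le: "infdist z (numerical_range T) \<le> cmod (q - z)"
    using infdist_le[of q "numerical_range T" z] by (simp add: dist_norm norm_minus_commute)
  have "q = c * cnj c * cinner (T *\<^sub>V x) x"
    by (simp add: q_def cblinfun_apply_scaleC cinner_scaleC_left cinner_scaleC_right)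
  then have "q * complex_of_real ((norm x)\<^sup>2) = cinner (T *\<^sub>V x) x"
    using c by (simp add: mult.assoc mult.left_commute mult.commute)
  then have "cinner ((T - z *\<^sub>C id_cblinfun) *\<^sub>V x) x = (q - z) * complex_of_real ((norm x)\<^sup>2)"
    by (simp add: cblinfun.diff_left cinner_diff_left cinner_scaleC_left cinner_self algebra_simps)
  then have "cmod (cinner ((T - z *\<^sub>C id_cblinfun) *\<^sub>V x) x) = cmod (q - z) * (norm x)\<^sup>2"
    by (simp add: norm_mult norm_power)
  then show ?thesis using le by (simp add: mult_right_mono)
qed simp

lemma norm_le_of_mem_numerical_range:
  assumes "w \<in> numerical_range T"
  shows "cmod w \<le> norm T"
proof -
  have "cmod (cinner (T *\<^sub>V x) x) \<le> norm T" if "norm x = 1" for x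
    using cinner_Cauchy_Schwarz[of "T *\<^sub>V x" x] norm_cblinfun_apply[of T x] that by simp
  then have "numerical_range T \<subseteq> cball 0 (norm T)"
    unfolding numerical_range_def by (intro closure_minimal) auto
  then show ?thesis using assms by auto
qed

definition resolvent :: "('a::complex_normed_vector \<Rightarrow>\<^sub>C\<^sub>L 'a) \<Rightarrow> complex \<Rightarrow> 'a \<Rightarrow>\<^sub>C\<^sub>L 'a" where
  "resolvent Z z = cblinfun_inv (Z - z *\<^sub>C id_cblinfun)"

lemma resolvent_perturbed:
  assumes X: "norm X < infdist z (numerical_range T)"
  shows "resolvent (T + X) z o\<^sub>C\<^sub>L (T + X - z *\<^sub>C id_cblinfun) = id_cblinfun"
    and "(T + X - z *\<^sub>C id_cblinfun) o\<^sub>C\<^sub>L resolvent (T + X) z = id_cblinfun"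
    and "norm (resolvent (T + X) z) \<le> 1 / (infdist z (numerical_range T) - norm X)"
proof -
  let ?m = "infdist z (numerical_range T) - norm X"
  have "?m * (norm x)\<^sup>2 \<le> cmod (cinner ((T + X - z *\<^sub>C id_cblinfun) *\<^sub>V x) x)" for x
  proof -
    have "cinner ((T + X - z *\<^sub>C id_cblinfun) *\<^sub>V x) x
       = cinner ((T - z *\<^sub>C id_cblinfun) *\<^sub>V x) x + cinner (X *\<^sub>V x) x"
      by (simp add: cblinfun.add_left cblinfun.diff_left cinner_add_left cinner_diff_left)
    moreover have "cmod (cinner (X *\<^sub>V x) x) \<le> norm X * (norm x)\<^sup>2"
      using cinner_Cauchy_Schwarz[of "X *\<^sub>V x" x] mult_right_mono[OF norm_cblinfun_apply[of X x], of "norm x"]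
      by (simp add: power2_eq_square mult.assoc)
    ultimately show ?thesis
      using infdist_numerical_range_le[of z T x]
        norm_diff_ineq[of "cinner ((T - z *\<^sub>C id_cblinfun) *\<^sub>V x) x" "cinner (X *\<^sub>V x) x"]
      by (simp add: left_diff_distrib)
  qed
  then obtain R where R: "R o\<^sub>C\<^sub>L (T + X - z *\<^sub>C id_cblinfun) = id_cblinfun"
    "(T + X - z *\<^sub>C id_cblinfun) o\<^sub>C\<^sub>L R = id_cblinfun" "norm R \<le> 1 / ?m"
    using Lax_Milgram[of ?m "T + X - z *\<^sub>C id_cblinfun"] X by auto
  then have "resolvent (T + X) z = R" unfolding resolvent_def by (intro cblinfun_inv_eqI)
  with R show "resolvent (T + X) z o\<^sub>C\<^sub>L (T + X - z *\<^sub>C id_cblinfun) = id_cblinfun"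
    "(T + X - z *\<^sub>C id_cblinfun) o\<^sub>C\<^sub>L resolvent (T + X) z = id_cblinfun"
    "norm (resolvent (T + X) z) \<le> 1 / ?m" by simp_all
qed

lemma spectrum_perturbed:
  assumes "z \<in> spectrum UNIV (cblinfun_apply (T + X))"
  shows "infdist z (numerical_range T) \<le> norm X"
proof (rule ccontr)
  assume "\<not> infdist z (numerical_range T) \<le> norm X"
  then have X: "norm X < infdist z (numerical_range T)" by simp
  have "(T + X) *\<^sub>V resolvent (T + X) z *\<^sub>V y - z *\<^sub>C (resolvent (T + X) z *\<^sub>V y) = y"
    "resolvent (T + X) z *\<^sub>V ((T + X) *\<^sub>V y - z *\<^sub>C y) = y" for y
    using arg_cong[OF resolvent_perturbed(2)[OF X], of "\<lambda>S. S *\<^sub>V y"]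
      arg_cong[OF resolvent_perturbed(1)[OF X], of "\<lambda>S. S *\<^sub>V y"]
    by (simp_all add: cblinfun.diff_left)
  then have "z \<in> resolvent_set UNIV (cblinfun_apply (T + X))"
    unfolding resolvent_set_def by blast
  then show False using assms by (simp add: spectrum_def)
qed

lemma contour_dist_le_infdist:
  assumes "\<mu> \<in> contour_set g \<beta>"
  shows "contour_dist T g \<beta> \<le> infdist \<mu> (numerical_range T)"
proof -
  have "contour_dist T g \<beta> \<le> setdist (numerical_range T) {\<mu>}"
    unfolding contour_dist_def using assms by (intro setdist_subset_right) auto
  then show ?thesis by (simp add: infdist_eq_setdist setdist_sym)
qed

text \<open>A spectral point z has distance at most \<open>norm X\<close> from the numerical range,
  while contour points have at least \<open>contour_dist T g \<beta>\<close>; the triangle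
  inequality leaves their difference as a uniform gap.\<close>

lemma spectrum_off_perturbed:
  assumes X: "norm X < contour_dist T g \<beta>"
  shows "spectrum_off (T + X) (contour_set g \<beta>)"
  unfolding spectrum_off_def
proof (intro exI conjI ballI)
  show "contour_dist T g \<beta> - norm X > 0" using X by simp
  fix z \<mu> assume "z \<in> spectrum UNIV (cblinfun_apply (T + X))" "\<mu> \<in> contour_set g \<beta>"
  then show "contour_dist T g \<beta> - norm X \<le> dist z \<mu>"
    using spectrum_perturbed[of z T X] contour_dist_le_infdist[of \<mu> g \<beta> T]
      infdist_triangle[of \<mu> "numerical_range T" z] by (simp add: dist_commute)
qed

text \<open>The resolvent identity in a form that covers both a shift of the spectral parameter
  (continuity in \<mu>) and a perturbation of the operator (Lipschitz dependence on X).\<close>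

lemma inverse_diff_cblinfun:
  assumes "R o\<^sub>C\<^sub>L W = id_cblinfun" "W' o\<^sub>C\<^sub>L R' = id_cblinfun"
  shows "R - R' = R o\<^sub>C\<^sub>L (W' - W) o\<^sub>C\<^sub>L R'"
proof (rule cblinfun_eqI)
  fix x
  have "R *\<^sub>V W *\<^sub>V R' *\<^sub>V x = R' *\<^sub>V x" "W' *\<^sub>V R' *\<^sub>V x = x"
    using arg_cong[OF assms(1), of "\<lambda>S. S *\<^sub>V R' *\<^sub>V x"] arg_cong[OF assms(2), of "\<lambda>S. S *\<^sub>V x"] by auto
  then show "(R - R') *\<^sub>V x = (R o\<^sub>C\<^sub>L (W' - W) o\<^sub>C\<^sub>L R') *\<^sub>V x"
    by (simp add: cblinfun.diff_left cblinfun.diff_right)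
qed

lemma norm_cblinfun_compose3: "norm (R o\<^sub>C\<^sub>L S o\<^sub>C\<^sub>L T) \<le> norm R * norm S * norm T"
  by (rule order_trans[OF norm_cblinfun_compose mult_right_mono[OF norm_cblinfun_compose]]) simp

text \<open>Only an inequality, because the norm is 0 on the trivial space.\<close>

lemma norm_id_cblinfun_le: "norm (id_cblinfun :: 'a::complex_normed_vector \<Rightarrow>\<^sub>C\<^sub>L 'a) \<le> 1"
  by (rule norm_cblinfun_bound) auto

text \<open>With \<kappa> the uniform bound of the resolvent on the contour, the resolvent identity
  gives the Lipschitz constant \<kappa> squared.\<close>

lemma continuous_on_resolvent:
  assumes X: "norm X < contour_dist T g \<beta>"
  shows "continuous_on (contour_set g \<beta>) (resolvent (T + X))"
proof (rule lipschitz_on_continuous_on)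
  let ?\<kappa> = "1 / (contour_dist T g \<beta> - norm X)"
  have lt: "norm X < infdist \<mu> (numerical_range T)" if "\<mu> \<in> contour_set g \<beta>" for \<mu>
    using contour_dist_le_infdist[OF that, of T] X by simp
  have norm_R: "norm (resolvent (T + X) \<mu>) \<le> ?\<kappa>" if "\<mu> \<in> contour_set g \<beta>" for \<mu>
    using contour_dist_le_infdist[OF that, of T] X
    by (intro order_trans[OF resolvent_perturbed(3)[OF lt[OF that]]] divide_left_mono) auto
  show "lipschitz_on (?\<kappa> * ?\<kappa>) (contour_set g \<beta>) (resolvent (T + X))"
  proof (rule lipschitz_onI)
    fix \<mu> \<nu> assume \<mu>: "\<mu> \<in> contour_set g \<beta>" and \<nu>: "\<nu> \<in> contour_set g \<beta>"
    have "resolvent (T + X) \<mu> - resolvent (T + X) \<nu>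
        = resolvent (T + X) \<mu> o\<^sub>C\<^sub>L ((\<mu> - \<nu>) *\<^sub>C id_cblinfun) o\<^sub>C\<^sub>L resolvent (T + X) \<nu>"
      by (subst inverse_diff_cblinfun[OF resolvent_perturbed(1)[OF lt[OF \<mu>]] resolvent_perturbed(2)[OF lt[OF \<nu>]]])
        (simp add: scaleC.diff_left)
    also have "norm \<dots> \<le> norm (resolvent (T + X) \<mu>) * norm ((\<mu> - \<nu>) *\<^sub>C (id_cblinfun :: 'a \<Rightarrow>\<^sub>C\<^sub>L 'a)) * norm (resolvent (T + X) \<nu>)"
      by (rule norm_cblinfun_compose3)
    also have "\<dots> \<le> ?\<kappa> * dist \<mu> \<nu> * ?\<kappa>"
      using X norm_R[OF \<mu>] norm_R[OF \<nu>] norm_id_cblinfun_le[where 'a = 'a]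
      by (intro mult_mono) (auto simp: norm_scaleC dist_norm intro: mult_left_le)
    finally show "dist (resolvent (T + X) \<mu>) (resolvent (T + X) \<nu>) \<le> ?\<kappa> * ?\<kappa> * dist \<mu> \<nu>"
      by (simp add: dist_norm mult_ac)
  qed simp
qed

section \<open>The fixed-point equation\<close>

lemma has_contour_integral_op_diff:
  assumes "has_contour_integral_op g \<beta> F I" "has_contour_integral_op g \<beta> G J"
  shows "has_contour_integral_op g \<beta> (\<lambda>\<mu>. F \<mu> - G \<mu>) (I - J)"
proof -
  from assms(1) obtain I1 I2 where I: "has_arc_integral g F I1"
    "((\<lambda>t. F (complex_of_real t)) has_integral I2) {\<beta>..}" "I = I1 + I2"
    unfolding has_contour_integral_op_def by blast
  from assms(2) obtain J1 J2 where J: "has_arc_integral g G J1"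
    "((\<lambda>t. G (complex_of_real t)) has_integral J2) {\<beta>..}" "J = J1 + J2"
    unfolding has_contour_integral_op_def by blast
  show ?thesis unfolding has_contour_integral_op_def
    using has_arc_integral_diff[OF I(1) J(1)] has_integral_diff[OF I(2) J(2)] I(3) J(3)
    by (intro exI[of _ "I1 - J1"] exI[of _ "I2 - J2"]) simp
qed

section \<open>Majorants on the whole contour\<close>

context
  fixes g :: "real \<Rightarrow> complex" and \<phi> :: "complex \<Rightarrow> real" and \<beta> :: real
  assumes rect: "rectifiable g" and cont_g: "continuous_on {0..1} g"
    and cont_arc: "continuous_on {0<..<1} (\<lambda>t. \<phi> (g t))"
    and cont_ray: "continuous_on {\<beta>..} (\<lambda>t. \<phi> (complex_of_real t))"
    and nonneg: "\<And>\<mu>. \<phi> \<mu> \<ge> 0"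
    and fin: "arclength_integral g \<beta> \<phi> < \<infinity>"
begin

lemma contour_integral_majorized:
  fixes F :: "complex \<Rightarrow> 'b::{complex_normed_vector,banach}"
  assumes M: "M \<ge> 0" and F: "\<And>\<mu>. \<mu> \<in> contour_set g \<beta> \<Longrightarrow> norm (F \<mu>) \<le> M * \<phi> \<mu>"
  shows "has_contour_integral_op g \<beta> F I \<Longrightarrow> norm I \<le> M * enn2real (arclength_integral g \<beta> \<phi>)"
    and "continuous_on {0<..<1} (\<lambda>t. F (g t)) \<Longrightarrow> continuous_on {\<beta>..} (\<lambda>t. F (complex_of_real t)) \<Longrightarrow>
      \<exists>I. has_contour_integral_op g \<beta> F I"
proof -
  define W1 where "W1 = (\<integral>\<^sup>+t\<in>{0<..<1}. ennreal (\<phi> (g t)) \<partial>interval_measure (arc_length g))"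
  define W2 where "W2 = (\<integral>\<^sup>+t\<in>{\<beta>..}. ennreal (\<phi> (complex_of_real t)) \<partial>lborel)"
  have W: "arclength_integral g \<beta> \<phi> = W1 + W2" by (simp add: arclength_integral_def W1_def W2_def)
  have fin1: "W1 < \<infinity>" and fin2: "W2 < \<infinity>" using fin W by auto
  obtain \<Psi> where \<Psi>:
    "\<And>s t m. 0 < s \<Longrightarrow> s \<le> t \<Longrightarrow> t < 1 \<Longrightarrow> (\<And>r. s \<le> r \<Longrightarrow> r \<le> t \<Longrightarrow> m \<le> \<phi> (g r)) \<Longrightarrow>
       m * (arc_length g t - arc_length g s) \<le> \<Psi> t - \<Psi> s"
    "\<And>t. 0 < t \<Longrightarrow> t < 1 \<Longrightarrow> 0 \<le> \<Psi> t \<and> \<Psi> t \<le> enn2real W1"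
    using ex_indefinite_stieltjes_integral[OF mono_arc_length[OF rect] continuous_arc_length[OF rect cont_g] cont_arc
        fin1[unfolded W1_def], folded W1_def] by metis
  have arc: "cmod (g t - g s) \<le> arc_length g t - arc_length g s" if "0 < s" "s \<le> t" "t < 1" for s t
    using that by (intro norm_diff_le_arc_length[OF rect]) auto
  have F_arc: "norm (F (g t)) \<le> M * \<phi> (g t)" if "0 < t" "t < 1" for t
    using that by (intro F) (auto simp: contour_set_def path_image_def)
  have F_ray: "norm (F (complex_of_real t)) \<le> M * \<phi> (complex_of_real t)" if "t \<ge> \<beta>" for t
    using that by (intro F) (auto simp: contour_set_def)
  {
    assume "has_contour_integral_op g \<beta> F I"
    then obtain I1 I2 where I: "has_arc_integral g F I1"
      "((\<lambda>t. F (complex_of_real t)) has_integral I2) {\<beta>..}" "I = I1 + I2"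
      unfolding has_contour_integral_op_def by blast
    have "norm I1 \<le> M * enn2real W1"
      by (rule has_arc_integral_bound[OF arc M cont_arc nonneg \<Psi> F_arc I(1)])
    moreover have "norm I2 \<le> M * enn2real W2"
      unfolding W2_def by (rule ray_integral_bound[OF cont_ray nonneg fin2[unfolded W2_def] M F_ray I(2)])
    moreover have "enn2real (W1 + W2) = enn2real W1 + enn2real W2"
      using fin1 fin2 by (simp add: enn2real_plus)
    ultimately show "norm I \<le> M * enn2real (arclength_integral g \<beta> \<phi>)"
      unfolding W I(3) by (simp add: distrib_left norm_triangle_le)
  next
    assume c: "continuous_on {0<..<1} (\<lambda>t. F (g t))" "continuous_on {\<beta>..} (\<lambda>t. F (complex_of_real t))"
    have "\<exists>I1. has_arc_integral g F I1"
      by (rule has_arc_integral_exists[OF arc M cont_arc nonneg \<Psi> F_arc c(1)])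
    moreover have "\<exists>I2. ((\<lambda>t. F (complex_of_real t)) has_integral I2) {\<beta>..}"
      by (rule ray_integral_exists[OF cont_ray nonneg fin2[unfolded W2_def] M F_ray c(2)])
    ultimately show "\<exists>I. has_contour_integral_op g \<beta> F I"
      unfolding has_contour_integral_op_def by blast
  }
qed

end

text \<open>\<open>r_min\<close> is a root of \<open>v d (a + r) = r (d - r)\<close>, which makes \<open>\<parallel>X\<parallel> \<le> r_min\<close> invariant;
  \<open>r < r_max\<close> is \<open>v d (d + a) < (d - r)\<^sup>2\<close>, the contraction condition.\<close>

lemma radii:
  fixes d v a :: real
  assumes d: "d > 0" and v: "0 \<le> v" "v < 1" and a: "a \<ge> 0"
    and adm: "v * a < 1/4 * d * (1 - v)\<^sup>2"
  shows "0 \<le> r_min d v a" "r_min d v a < r_max d v a" "r_max d v a \<le> d"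
    and "v * (d * (a + r_min d v a)) = r_min d v a * (d - r_min d v a)"
    and "r < r_max d v a \<Longrightarrow> v * (d * (d + a)) < (d - r)\<^sup>2"
proof -
  \<comment> \<open>A quarter of the discriminant of
    \<open>r\<^sup>2 - d * (1 - v) * r + d * v * a = 0\<close>, whose smaller root is
    \<open>r_min d v a\<close>; admissibility says \<open>D > 0\<close>.\<close>
  define D where "D = 1/4 * d\<^sup>2 * (1 - v)\<^sup>2 - d * v * a"
  have "d * (v * a) < d * (1/4 * d * (1 - v)\<^sup>2)" using adm d by (rule mult_strict_left_mono)
  then have D: "D > 0" by (simp add: D_def power2_eq_square algebra_simps)
  have sq: "(sqrt D)\<^sup>2 = D" using D by simp
  have rm: "r_min d v a = d * (1 - v) / 2 - sqrt D" by (simp add: r_min_def D_def)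
  have "sqrt D \<le> sqrt ((d * (1 - v) / 2)\<^sup>2)"
    using d v a by (intro real_sqrt_le_mono) (simp add: D_def power_mult_distrib power_divide)
  then have "sqrt D \<le> d * (1 - v) / 2" using d v by simp
  then show "0 \<le> r_min d v a" by (simp add: rm)
  have nn: "v * d * (d + a) \<ge> 0" using d v a by simp
  then show "r_max d v a \<le> d" by (simp add: r_max_def)
  \<comment> \<open>Since \<open>(1 - v)\<^sup>2 / 4 + v = ((1 + v) / 2)\<^sup>2\<close>,
    admissibility bounds the square root in \<open>r_max\<close> by \<open>d * (1 + v) / 2\<close>;
    hence \<open>d * (1 - v) / 2\<close> separates the two radii.\<close>
  have "d * (v * (d + a)) < d * (d * ((1 + v) / 2)\<^sup>2)"
    using adm by (intro mult_strict_left_mono[OF _ d]) (simp add: power2_eq_square field_simps)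
  then have "v * d * (d + a) < (d * ((1 + v) / 2))\<^sup>2" by (simp add: power2_eq_square mult_ac)
  then have "sqrt (v * d * (d + a)) < d * ((1 + v) / 2)"
    using d v by (intro real_less_lsqrt) auto
  moreover have "r_min d v a \<le> d * (1 - v) / 2" using D by (simp add: rm)
  ultimately show "r_min d v a < r_max d v a" by (simp add: r_max_def field_simps)
  show "v * (d * (a + r_min d v a)) = r_min d v a * (d - r_min d v a)"
  proof -
    have "r_min d v a * (d - r_min d v a) - v * d * r_min d v a
        = (d * (1 - v) / 2)\<^sup>2 - (sqrt D)\<^sup>2"
      unfolding rm by (simp add: power2_eq_square field_simps)
    also have "\<dots> = d * v * a" unfolding sq by (simp add: D_def power2_eq_square field_simps)
    finally have "r_min d v a * (d - r_min d v a) = d * v * a + v * d * r_min d v a" by linarith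
    then show ?thesis by (simp add: distrib_left mult_ac)
  qed
  assume "r < r_max d v a"
  then have "sqrt (v * d * (d + a)) < d - r" by (simp add: r_max_def)
  then have "(sqrt (v * d * (d + a)))\<^sup>2 < (d - r)\<^sup>2"
    using nn by (intro power_strict_mono) auto
  then show "v * (d * (d + a)) < (d - r)\<^sup>2" using nn by (simp add: mult.assoc)
qed

text \<open>\<open>(\<delta> + b) / (\<delta> - r) = 1 + (b + r) / (\<delta> - r)\<close> does not
  increase with \<delta>, so the least distance d is the worst case. It is used with
  \<open>b = 0\<close> and with b the norm of the operator.\<close>

lemma quotient_le:
  fixes d \<delta> r \<rho> b :: real
  assumes "0 \<le> \<rho>" "\<rho> \<le> r" "r < d" "d \<le> \<delta>" "0 \<le> b"
  shows "(\<delta> + b) / (\<delta> - \<rho>) \<le> (d + b) / (d - r)"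
proof -
  have "(\<delta> + b) / (\<delta> - \<rho>) \<le> (\<delta> + b) / (\<delta> - r)"
    using assms by (intro divide_left_mono) auto
  also have "\<dots> \<le> (d + b) / (d - r)"
  proof -
    have "0 \<le> (\<delta> - d) * (b + r)" using assms by simp
    then show ?thesis using assms by (simp add: divide_le_eq pos_le_divide_eq algebra_simps frac_le_eq)
  qed
  finally show ?thesis .
qed

text \<open>\<open>pr\<close> hides the order of the factors: composition for one transformation,
  composition with exchanged arguments for the other. Continuity is asked on the open arc only,
  since \<open>K'\<close> may be singular at its ends.\<close>

locale contour_equation =
  fixes T :: "'a::complex_hilbert \<Rightarrow>\<^sub>C\<^sub>L 'a" and g :: "real \<Rightarrow> complex" and \<beta> :: real
    and K' :: "complex \<Rightarrow> ('a \<Rightarrow>\<^sub>C\<^sub>L 'a)"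
    and pr :: "('a \<Rightarrow>\<^sub>C\<^sub>L 'a) \<Rightarrow> ('a \<Rightarrow>\<^sub>C\<^sub>L 'a) \<Rightarrow> ('a \<Rightarrow>\<^sub>C\<^sub>L 'a)"
  assumes rect: "rectifiable g" and path: "continuous_on {0..1} g"
    and cont_arc: "continuous_on {0<..<1} (\<lambda>t. K' (g t))"
    and cont_ray: "continuous_on {\<beta>..} (\<lambda>t. K' (complex_of_real t))"
    and dist_pos: "contour_dist T g \<beta> > 0"
    and var_less: "contour_var T K' g \<beta> < 1"
    and pr: "bounded_bilinear pr" and norm_pr: "norm (pr R S) \<le> norm R * norm S"
begin

interpretation pr: bounded_bilinear pr by (rule pr)

abbreviation "d \<equiv> contour_dist T g \<beta>"
abbreviation "v \<equiv> enn2real (contour_var T K' g \<beta>)"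
abbreviation "\<delta> \<mu> \<equiv> infdist \<mu> (numerical_range T)"
abbreviation "\<Gamma> \<equiv> contour_set g \<beta>"

definition integrand :: "('a \<Rightarrow>\<^sub>C\<^sub>L 'a) \<Rightarrow> complex \<Rightarrow> ('a \<Rightarrow>\<^sub>C\<^sub>L 'a)" where
  "integrand X \<mu> = pr (K' \<mu>) ((T + X) o\<^sub>C\<^sub>L resolvent (T + X) \<mu>)"

text \<open>The equation of the theorem reads \<open>solves X X\<close>. It is a relation because
  definedness of the transformation is part of it.\<close>

definition solves :: "('a \<Rightarrow>\<^sub>C\<^sub>L 'a) \<Rightarrow> ('a \<Rightarrow>\<^sub>C\<^sub>L 'a) \<Rightarrow> bool" where
  "solves X I \<longleftrightarrow> spectrum_off (T + X) \<Gamma> \<and> has_contour_integral_op g \<beta> (integrand X) I"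

lemma \<delta>_ge: "\<mu> \<in> \<Gamma> \<Longrightarrow> d \<le> \<delta> \<mu>"
  by (rule contour_dist_le_infdist)

lemma arc_in_\<Gamma>: "t \<in> {0<..<1} \<Longrightarrow> g t \<in> \<Gamma>" and ray_in_\<Gamma>: "t \<in> {\<beta>..} \<Longrightarrow> complex_of_real t \<in> \<Gamma>"
  by (auto simp: contour_set_def path_image_def)

text \<open>The majorant is M times the density of Var, whose total mass is v; M absorbs the
  operator bounds.\<close>

lemma majorized:
  fixes F :: "complex \<Rightarrow> 'a \<Rightarrow>\<^sub>C\<^sub>L 'a"
  assumes M: "M \<ge> 0" and F: "\<And>\<mu>. \<mu> \<in> \<Gamma> \<Longrightarrow> norm (F \<mu>) \<le> M * (norm (K' \<mu>) / \<delta> \<mu>)"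
  shows "has_contour_integral_op g \<beta> F I \<Longrightarrow> norm I \<le> M * v"
    and "continuous_on {0<..<1} (\<lambda>t. F (g t)) \<Longrightarrow> continuous_on {\<beta>..} (\<lambda>t. F (complex_of_real t)) \<Longrightarrow>
      \<exists>I. has_contour_integral_op g \<beta> F I"
proof -
  have pos: "\<delta> \<mu> \<noteq> 0" if "\<mu> \<in> \<Gamma>" for \<mu> using \<delta>_ge[OF that] dist_pos by linarith
  have 1: "continuous_on {0<..<1} (\<lambda>t. norm (K' (g t)) / \<delta> (g t))"
    by (intro continuous_on_divide continuous_on_norm cont_arc continuous_on_infdist
        continuous_on_subset[OF path]) (use pos arc_in_\<Gamma> in auto)
  have 2: "continuous_on {\<beta>..} (\<lambda>t. norm (K' (complex_of_real t)) / \<delta> (complex_of_real t))"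
    by (intro continuous_on_divide continuous_on_norm cont_ray continuous_on_infdist
        continuous_intros) (use pos ray_in_\<Gamma> in auto)
  have 3: "norm (K' \<mu>) / \<delta> \<mu> \<ge> 0" for \<mu> by (simp add: infdist_nonneg)
  have 4: "arclength_integral g \<beta> (\<lambda>\<mu>. norm (K' \<mu>) / \<delta> \<mu>) < \<infinity>"
    using var_less unfolding contour_var_def by (rule less_trans) simp
  note m = contour_integral_majorized[where \<phi> = "\<lambda>\<mu>. norm (K' \<mu>) / \<delta> \<mu>", OF rect path 1 2 3 4 M F,
      folded contour_var_def]
  show "has_contour_integral_op g \<beta> F I \<Longrightarrow> norm I \<le> M * v"
    by (rule m(1))
  show "continuous_on {0<..<1} (\<lambda>t. F (g t)) \<Longrightarrow> continuous_on {\<beta>..} (\<lambda>t. F (complex_of_real t)) \<Longrightarrow>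
      \<exists>I. has_contour_integral_op g \<beta> F I"
    by (rule m(2))
qed

lemma norm_resolvent_le:
  assumes "norm X \<le> r" "r < d" "\<mu> \<in> \<Gamma>"
  shows "norm X < \<delta> \<mu>" "norm (resolvent (T + X) \<mu>) \<le> 1 / (\<delta> \<mu> - norm X)"
proof -
  show lt: "norm X < \<delta> \<mu>" using assms \<delta>_ge by fastforce
  show "norm (resolvent (T + X) \<mu>) \<le> 1 / (\<delta> \<mu> - norm X)" by (rule resolvent_perturbed(3)[OF lt])
qed

lemma norm_integrand_le:
  assumes X: "norm X \<le> r" "r < d" and \<mu>: "\<mu> \<in> \<Gamma>"
  shows "norm (integrand X \<mu>) \<le> d * (norm T + r) / (d - r) * (norm (K' \<mu>) / \<delta> \<mu>)"
proof -
  note R = norm_resolvent_le[OF X \<mu>]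
  have \<delta>: "0 < d" "d \<le> \<delta> \<mu>" using dist_pos \<delta>_ge[OF \<mu>] by auto
  have "norm ((T + X) o\<^sub>C\<^sub>L resolvent (T + X) \<mu>) \<le> (norm T + r) * (1 / (\<delta> \<mu> - norm X))"
    using R X norm_triangle_ineq[of T X] order_trans[OF norm_ge_zero X(1)]
    by (intro order_trans[OF norm_cblinfun_compose] mult_mono) auto
  \<comment> \<open>Expanding by \<delta> splits off the factor \<open>1 / \<delta>\<close> of the
    density of Var; the remaining quotient is then estimated by its value at d.\<close>
  also have "\<dots> = (norm T + r) * ((\<delta> \<mu> + 0) / (\<delta> \<mu> - norm X)) / \<delta> \<mu>"
    using \<delta> by simp
  also have "\<dots> \<le> (norm T + r) * ((d + 0) / (d - r)) / \<delta> \<mu>"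
    using \<delta> X order_trans[OF norm_ge_zero X(1)]
    by (intro divide_right_mono mult_left_mono quotient_le) auto
  finally have "norm ((T + X) o\<^sub>C\<^sub>L resolvent (T + X) \<mu>) \<le> d * (norm T + r) / (d - r) / \<delta> \<mu>"
    by (simp add: mult.commute)
  then have "norm (K' \<mu>) * norm ((T + X) o\<^sub>C\<^sub>L resolvent (T + X) \<mu>)
      \<le> norm (K' \<mu>) * (d * (norm T + r) / (d - r) / \<delta> \<mu>)"
    by (rule mult_left_mono) simp
  then show ?thesis unfolding integrand_def
    by (intro order_trans[OF norm_pr]) (simp add: mult_ac)
qed

lemma resolvent_identity:
  assumes X: "norm X < \<delta> \<mu>"
  shows "(T + X) o\<^sub>C\<^sub>L resolvent (T + X) \<mu> = id_cblinfun + \<mu> *\<^sub>C resolvent (T + X) \<mu>"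
proof (rule cblinfun_eqI)
  fix x
  show "((T + X) o\<^sub>C\<^sub>L resolvent (T + X) \<mu>) *\<^sub>V x = (id_cblinfun + \<mu> *\<^sub>C resolvent (T + X) \<mu>) *\<^sub>V x"
    using arg_cong[OF resolvent_perturbed(2)[OF X], of "\<lambda>S. S *\<^sub>V x"]
    by (simp add: cblinfun.diff_left cblinfun.add_left[of id_cblinfun] algebra_simps)
qed

lemma norm_le_\<delta>: "cmod \<mu> \<le> \<delta> \<mu> + norm T"
proof -
  \<comment> \<open>\<open>setdist\<close> is 0 when one set is empty, so a positive distance rules
    out the trivial space.\<close>
  have "numerical_range T \<noteq> {}" using dist_pos by (auto simp: contour_dist_def)
  moreover have "cmod \<mu> - norm T \<le> dist \<mu> w" if "w \<in> numerical_range T" for w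
    using norm_le_of_mem_numerical_range[OF that] norm_triangle_ineq2[of \<mu> w] by (simp add: dist_norm)
  ultimately have "cmod \<mu> - norm T \<le> \<delta> \<mu>"
    unfolding infdist_def by (auto intro: cINF_greatest)
  then show ?thesis by simp
qed

lemma norm_integrand_diff_le:
  assumes X: "norm X \<le> r" and Y: "norm Y \<le> r" and r: "r < d" and \<mu>: "\<mu> \<in> \<Gamma>"
  shows "norm (integrand X \<mu> - integrand Y \<mu>)
    \<le> d * (d + norm T) / (d - r)\<^sup>2 * norm (X - Y) * (norm (K' \<mu>) / \<delta> \<mu>)"
proof -
  let ?R = "\<lambda>X. resolvent (T + X) \<mu>"
  note RX = norm_resolvent_le[OF X r \<mu>] and RY = norm_resolvent_le[OF Y r \<mu>]
  have \<delta>: "0 < d" "d \<le> \<delta> \<mu>" using dist_pos \<delta>_ge[OF \<mu>] by auto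
  have "(T + X) o\<^sub>C\<^sub>L ?R X - (T + Y) o\<^sub>C\<^sub>L ?R Y = \<mu> *\<^sub>C (?R X - ?R Y)"
    by (simp add: resolvent_identity[OF RX(1)] resolvent_identity[OF RY(1)] scaleC.diff_right)
  also have "?R X - ?R Y = ?R X o\<^sub>C\<^sub>L (Y - X) o\<^sub>C\<^sub>L ?R Y"
    by (subst inverse_diff_cblinfun[OF resolvent_perturbed(1)[OF RX(1)] resolvent_perturbed(2)[OF RY(1)]]) simp
  finally have "norm ((T + X) o\<^sub>C\<^sub>L ?R X - (T + Y) o\<^sub>C\<^sub>L ?R Y)
      \<le> cmod \<mu> * (norm (?R X) * norm (X - Y) * norm (?R Y))"
    by (simp add: norm_scaleC mult_left_mono norm_cblinfun_compose3 norm_minus_commute[of X])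
  also have "\<dots> \<le> (\<delta> \<mu> + norm T) * (1 / (\<delta> \<mu> - norm X) * norm (X - Y) * (1 / (\<delta> \<mu> - norm Y)))"
    using RX RY infdist_nonneg[of \<mu> "numerical_range T"] by (intro mult_mono norm_le_\<delta>) auto
  \<comment> \<open>One resolvent factor is paired with the bound of \<mu>, the other with an
    inserted \<delta>, which leaves \<open>1 / \<delta>\<close> for the density of Var.\<close>
  also have "\<dots> = (\<delta> \<mu> + norm T) / (\<delta> \<mu> - norm X) * ((\<delta> \<mu> + 0) / (\<delta> \<mu> - norm Y)) * norm (X - Y) / \<delta> \<mu>"
    using \<delta> by simp
  also have "\<dots> \<le> (d + norm T) / (d - r) * ((d + 0) / (d - r)) * norm (X - Y) / \<delta> \<mu>"
    using \<delta> X Y r RX(1) RY(1) order_trans[OF norm_ge_zero X]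
    by (intro divide_right_mono mult_right_mono mult_mono quotient_le) auto
  also have "\<dots> = d * (d + norm T) / (d - r)\<^sup>2 * norm (X - Y) / \<delta> \<mu>"
    by (simp add: power2_eq_square mult_ac)
  finally have "norm (K' \<mu>) * norm ((T + X) o\<^sub>C\<^sub>L ?R X - (T + Y) o\<^sub>C\<^sub>L ?R Y)
      \<le> norm (K' \<mu>) * (d * (d + norm T) / (d - r)\<^sup>2 * norm (X - Y) / \<delta> \<mu>)"
    by (rule mult_left_mono) simp
  then show ?thesis unfolding integrand_def pr.diff_right[symmetric]
    by (intro order_trans[OF norm_pr]) (simp add: mult_ac)
qed

lemma solves_exists:
  assumes X: "norm X < d"
  shows "\<exists>I. solves X I"
proof -
  note c = bounded_bilinear.continuous_on[OF pr]
    bounded_bilinear.continuous_on[OF bounded_bilinear_cblinfun_compose continuous_on_const]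
    continuous_on_compose2[OF continuous_on_resolvent[OF X]]
  have "\<exists>I. has_contour_integral_op g \<beta> (integrand X) I"
  proof (rule majorized(2)[OF _ norm_integrand_le[OF order_refl X]])
    show "0 \<le> d * (norm T + norm X) / (d - norm X)" using X dist_pos by simp
    show "continuous_on {0<..<1} (\<lambda>t. integrand X (g t))"
      unfolding integrand_def
      by (intro c cont_arc continuous_on_subset[OF path]) (use arc_in_\<Gamma> in auto)
    show "continuous_on {\<beta>..} (\<lambda>t. integrand X (complex_of_real t))"
      unfolding integrand_def
      by (intro c cont_ray continuous_intros) (use ray_in_\<Gamma> in auto)
  qed
  then show ?thesis unfolding solves_def using spectrum_off_perturbed[OF X] by blast
qed

lemma norm_solves_le:
  assumes "norm X \<le> r" "r < d" "solves X I"
  shows "norm I \<le> d * (norm T + r) / (d - r) * v"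
  using assms(3) unfolding solves_def
  by (intro majorized(1)[OF _ norm_integrand_le[OF assms(1,2)]])
    (use assms dist_pos order_trans[OF norm_ge_zero assms(1)] in auto)

lemma norm_solves_diff_le:
  assumes "norm X \<le> r" "norm Y \<le> r" "r < d" "solves X I" "solves Y J"
  shows "norm (I - J) \<le> v * (d * (d + norm T)) / (d - r)\<^sup>2 * norm (X - Y)"
proof -
  have "norm (I - J) \<le> d * (d + norm T) / (d - r)\<^sup>2 * norm (X - Y) * v"
    using assms(4,5) dist_pos unfolding solves_def
    by (intro majorized(1)[OF _ norm_integrand_diff_le[OF assms(1-3)]] has_contour_integral_op_diff) auto
  then show ?thesis by (simp add: mult_ac)
qed

theorem fixed_point:
  assumes adm: "v * norm T < 1/4 * d * (1 - v)\<^sup>2"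
  shows "\<exists>X. solves X X \<and> norm X \<le> r_min d v (norm T) \<and> norm X < r_max d v (norm T) \<and>
    (\<forall>Y. solves Y Y \<and> norm Y < r_max d v (norm T) \<longrightarrow> Y = X)"
proof -
  have "contour_var T K' g \<beta> < top" using var_less by (rule less_trans) simp
  \<comment> \<open>Finiteness of Var makes the passage to the real number v faithful.\<close>
  then have "ennreal v = contour_var T K' g \<beta>" by simp
  then have v: "0 \<le> v" "v < 1"
    using var_less ennreal_less_iff[of v 1] by (auto simp: enn2real_nonneg)
  note rad = radii[OF dist_pos v norm_ge_zero adm]
  define r where "r = r_min d v (norm T)"
  have r: "0 \<le> r" "r < r_max d v (norm T)" "r < d" using rad unfolding r_def by auto
  define \<kappa> where "\<kappa> s = v * (d * (d + norm T)) / (d - s)\<^sup>2" for s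
  have \<kappa>: "0 \<le> \<kappa> s" "\<kappa> s < 1" if "s < r_max d v (norm T)" for s
  proof -
    have "s < d" using that rad(3) by simp
    then show "0 \<le> \<kappa> s" "\<kappa> s < 1" using rad(5)[OF that] v dist_pos by (auto simp: \<kappa>_def divide_less_eq)
  qed
  have "\<forall>X. \<exists>I. norm X < d \<longrightarrow> solves X I" using solves_exists by blast
  \<comment> \<open>A choice of values of the transformation, arbitrary outside the ball of radius
    d.\<close>
  then obtain V where V: "\<And>X. norm X < d \<Longrightarrow> solves X (V X)" by metis
  have "\<exists>!X. X \<in> cball 0 r \<and> V X = X"
  proof (rule Banach_fix)
    show "complete (cball (0 :: 'a \<Rightarrow>\<^sub>C\<^sub>L 'a) r)" by (simp add: complete_eq_closed)
    show "V ` cball 0 r \<subseteq> cball 0 r"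
    proof (clarsimp)
      fix X :: "'a \<Rightarrow>\<^sub>C\<^sub>L 'a" assume X: "norm X \<le> r"
      have "norm (V X) \<le> d * (norm T + r) / (d - r) * v"
        by (rule norm_solves_le[OF X r(3) V]) (use X r in simp)
      also have "\<dots> = v * (d * (norm T + r)) / (d - r)" by simp
      \<comment> \<open>The quadratic equation for \<open>r_min\<close> expresses exactly this
        equality.\<close>
      also have "\<dots> = r" using rad(4) r unfolding r_def by simp
      finally show "norm (V X) \<le> r" .
    qed
    show "dist (V X) (V Y) \<le> \<kappa> r * dist X Y" if "X \<in> cball 0 r" "Y \<in> cball 0 r" for X Y
      unfolding dist_norm \<kappa>_def
      by (rule norm_solves_diff_le[where r = r]) (use that r V in auto)
  qed (use r \<kappa> in auto)
  then obtain X where X: "norm X \<le> r" "V X = X" by auto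
  then have sol: "solves X X" using V[of X] r by simp
  have "Y = X" if Y: "solves Y Y" "norm Y < r_max d v (norm T)" for Y
  proof (rule ccontr)
    assume "Y \<noteq> X"
    \<comment> \<open>Both solutions lie in the closed ball of radius s, where the contraction
      constant is below 1; this carries uniqueness from the ball of radius r to the open ball of
      radius \<open>r_max\<close>.\<close>
    define s where "s = max (norm X) (norm Y)"
    have s: "s < r_max d v (norm T)" using X Y r by (simp add: s_def)
    have "norm (X - Y) \<le> \<kappa> s * norm (X - Y)"
      unfolding \<kappa>_def by (rule norm_solves_diff_le[OF _ _ _ sol Y(1)]) (use s rad(3) in \<open>auto simp: s_def\<close>)
    moreover have "\<kappa> s * norm (X - Y) < 1 * norm (X - Y)"
      using \<kappa>(2)[OF s] \<open>Y \<noteq> X\<close> by (intro mult_strict_right_mono) auto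
    ultimately show False by simp
  qed
  then have "solves X X \<and> norm X \<le> r \<and> norm X < r_max d v (norm T) \<and>
      (\<forall>Y. solves Y Y \<and> norm Y < r_max d v (norm T) \<longrightarrow> Y = X)"
    using sol X(1) le_less_trans[OF X(1) r(2)] by blast
  then show ?thesis unfolding r_def ..
qed

end

theorem theorem3p2:
  fixes C :: "'c::{complex_hilbert, second_countable_topology} \<Rightarrow> 'c" and domC :: "'c set"
    and A :: "'a::{complex_hilbert, second_countable_topology} \<Rightarrow>\<^sub>C\<^sub>L 'a"
    and D :: "'a \<Rightarrow> 'c" and domD :: "'a set"
    and B :: "'c \<Rightarrow> 'a" and domB :: "'c set"
    and E :: "real \<Rightarrow> ('c \<Rightarrow>\<^sub>C\<^sub>L 'c)" and C_inv_sqrt :: "'c \<Rightarrow>\<^sub>C\<^sub>L 'c"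
    and Dt :: "'a \<Rightarrow>\<^sub>C\<^sub>L 'c" and Bt :: "'c \<Rightarrow>\<^sub>C\<^sub>L 'a" and At :: "'a \<Rightarrow>\<^sub>C\<^sub>L 'a"
    and lamC \<alpha>\<^sub>1 \<alpha>\<^sub>2 \<eta> \<beta> c \<gamma> :: real
    and \<D> :: "complex set"
    and K\<^sub>0 K\<^sub>0' :: "real \<Rightarrow> ('a \<Rightarrow>\<^sub>C\<^sub>L 'a)"
    and K\<^sub>1 K\<^sub>1' K' :: "complex \<Rightarrow> ('a \<Rightarrow>\<^sub>C\<^sub>L 'a)"
    and l :: int and g :: "real \<Rightarrow> complex"
  assumes C_self_adjoint: "self_adjoint domC C"
    and lamC_pos: "lamC > 0"
    and C_bounded_below: "\<forall>x\<in>domC. lamC * (norm x)\<^sup>2 \<le> Re (cinner (C x) x)"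
    and E_spectral_family: "spectral_family_of E domC C"
    and C_abs_continuous: "\<forall>x. absolutely_continuous lborel (spectral_measure E x)"
    and C_spectrum: "spectrum domC C = complex_of_real ` {lamC..}"
    and C_inv_sqrt: "spectral_integral E (\<lambda>t. t powr (- 1/2)) UNIV (cblinfun_apply C_inv_sqrt)"
    and D_operator: "densely_defined domD D" "closable domD D"
    and Dt: "\<forall>x\<in>domD. Dt *\<^sub>V x = C_inv_sqrt *\<^sub>V D x"
    and B_operator: "densely_defined domB B" "closable domB B"
    and B_dom: "spectral_dom E sqrt \<subseteq> domB"
    and Bt: "\<forall>y. Bt *\<^sub>V y = B (C_inv_sqrt *\<^sub>V y)"
    and At: "At = A - Bt o\<^sub>C\<^sub>L Dt"
    and parameters: "\<eta> > 0" "\<alpha>\<^sub>1 < \<alpha>\<^sub>2" "\<alpha>\<^sub>1 - \<eta> > lamC" "\<beta> > \<alpha>\<^sub>2 + \<eta>"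
    and numerical_range:
      "numerical_range At \<subseteq> {z. infdist z (complex_of_real ` {\<alpha>\<^sub>1..\<alpha>\<^sub>2}) \<le> \<eta>}"
    and K\<^sub>0: "\<forall>s. K\<^sub>0 s = Bt o\<^sub>C\<^sub>L E s o\<^sub>C\<^sub>L Dt"
    and K\<^sub>0_derivative: "\<forall>s>lamC. (K\<^sub>0 has_vector_derivative K\<^sub>0' s) (at s)"
    and K\<^sub>0'_continuous: "continuous_on {lamC<..} K\<^sub>0'"
    and domain: "open \<D>" "connected \<D>" "simply_connected \<D>"
      "{z. infdist z (complex_of_real ` {\<alpha>\<^sub>1..\<alpha>\<^sub>2}) \<le> \<eta>} \<subseteq> \<D>"
      "complex_of_real ` {lamC<..<\<beta>} \<subseteq> \<D>"
    and K\<^sub>1_extends: "\<forall>s\<in>{lamC<..<\<beta>}. K\<^sub>1 (complex_of_real s) = K\<^sub>0 s"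
    and K\<^sub>1_analytic: "\<forall>\<mu>\<in>\<D>. (K\<^sub>1 has_derivative (\<lambda>h. h *\<^sub>C K\<^sub>1' \<mu>)) (at \<mu>)"
    and exponents: "c > 0" "-1 < \<gamma>" "\<gamma> \<le> 0"
    and K\<^sub>1'_growth: "\<forall>x\<in>{lamC, \<beta>}. \<forall>\<^sub>F \<mu> in at (complex_of_real x) within \<D>.
           norm (K\<^sub>1' \<mu>) \<le> c * cmod (\<mu> - complex_of_real x) powr \<gamma>"
    and K\<^sub>0'_decay: "(\<integral>\<^sup>+s\<in>{\<beta>..}. ennreal (norm (K\<^sub>0' s) / (1 + \<bar>s\<bar>)) \<partial>lborel) < \<infinity>"
    and K': "K' = contour_deriv K\<^sub>0' K\<^sub>1'"
    and admissible_exist: "\<exists>g. admissible 1 lamC \<beta> \<D> At K' g" "\<exists>g. admissible (-1) lamC \<beta> \<D> At K' g"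
    and l: "l = 1 \<or> l = -1"
    and admissible: "admissible l lamC \<beta> \<D> At K' g"
  shows "\<forall>V\<in>{V_right g \<beta> K', V_left g \<beta> K'}.
    let d = contour_dist At g \<beta>; v = enn2real (contour_var At K' g \<beta>); a = norm At
    in \<exists>X. V (At + X) X \<and> norm X \<le> r_min d v a \<and> norm X < r_max d v a \<and>
           (\<forall>Y. V (At + Y) Y \<and> norm Y < r_max d v a \<longrightarrow> Y = X)"
proof -
  have \<beta>: "\<beta> > lamC" using parameters by linarith
  have contour: "is_contour l lamC \<beta> \<D> g" and d: "contour_dist At g \<beta> > 0"
    and v: "contour_var At K' g \<beta> < 1"
    and adm: "enn2real (contour_var At K' g \<beta>) * norm At
      < 1/4 * contour_dist At g \<beta> * (1 - enn2real (contour_var At K' g \<beta>))\<^sup>2"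
    using admissible unfolding admissible_def by blast+
  have rect: "rectifiable g" and "arc g" and arc_in: "\<And>t. t \<in> {0<..<1} \<Longrightarrow> g t \<in> \<D> \<and> of_int l * Im (g t) > 0"
    using contour unfolding is_contour_def by auto
  then have path: "continuous_on {0..1} g" by (simp add: arc_def path_def)
  \<comment> \<open>Differentiability of the continuation is the hypothesis; norm continuity of its
    derivative follows from Cauchy's inequality.\<close>
  have "continuous_on \<D> K\<^sub>1'"
    using K\<^sub>1_analytic by (intro continuous_on_complex_derivative[OF domain(1)]) auto
  then have "continuous_on {0<..<1} (\<lambda>t. K\<^sub>1' (g t))"
    by (rule continuous_on_compose2) (use arc_in in \<open>auto intro: continuous_on_subset[OF path]\<close>)
  \<comment> \<open>The imaginary part is nonzero on the open arc, so \<open>K'\<close> is there the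
    derivative of the continuation.\<close>
  then have cont_arc: "continuous_on {0<..<1} (\<lambda>t. K' (g t))"
    by (rule continuous_on_eq) (use arc_in in \<open>fastforce simp: K' contour_deriv_def\<close>)
  \<comment> \<open>On the real axis \<open>K'\<close> is \<open>K\<^sub>0'\<close>, and the ray
    starts at \<open>\<beta> > lamC\<close>, inside the region where that is continuous.\<close>
  have cont_ray: "continuous_on {\<beta>..} (\<lambda>t. K' (complex_of_real t))"
    using \<beta> by (auto simp: K' contour_deriv_def intro: continuous_on_subset[OF K\<^sub>0'_continuous])
  interpret R: contour_equation At g \<beta> K' "(o\<^sub>C\<^sub>L)"
    by (rule contour_equation.intro[OF rect path cont_arc cont_ray d v
        bounded_bilinear_cblinfun_compose norm_cblinfun_compose])
  have "norm (T o\<^sub>C\<^sub>L S) \<le> norm S * norm T" for S T :: "'a \<Rightarrow>\<^sub>C\<^sub>L 'a"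
    by (metis norm_cblinfun_compose mult.commute)
  then interpret L: contour_equation At g \<beta> K' "\<lambda>S T. T o\<^sub>C\<^sub>L S"
    by (rule contour_equation.intro[OF rect path cont_arc cont_ray d v
        bounded_bilinear.flip[OF bounded_bilinear_cblinfun_compose]])
  \<comment> \<open>Associativity regroups the triple composition in the right transformation as a
    product of \<open>K'\<close> with the rest, as in \<open>integrand\<close>.\<close>
  have "V_right g \<beta> K' (At + X) = R.solves X" "V_left g \<beta> K' (At + X) = L.solves X" for X
    by (auto simp: fun_eq_iff V_right_def V_left_def R.solves_def L.solves_def R.integrand_def[abs_def]
        L.integrand_def[abs_def] resolvent_def cblinfun_compose_assoc)
  then show ?thesis using R.fixed_point[OF adm] L.fixed_point[OF adm] by (simp add: Let_def)
qed

end
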